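(* Let $\mathfrak{F}$ be a $Q$-closed Fitting class of finite soluble groups, let $\gamma$ be the function assigning to every finite group its $\mathfrak{F}$-radical, and let $\pi=\pi(\mathfrak{F})$. If $M$ is a maximal subgroup of a finite soluble $\pi$-group $G$, then $h_\gamma(G)-h_\gamma(M)\leq 2$.
   Context: All groups are finite. A Fitting class is a nonempty class of groups (closed under isomorphism) $\mathfrak{F}$ that is closed under taking normal subgroups and such that $G=AB$ with $A,B\trianglelefteq G$ and $A,B\in\mathfrak{F}$ implies $G\in\mathfrak{F}$. The class is $Q$-closed if it is closed under epimorphic images. The $\mathfrak{F}$-radical of $G$ is the largest normal subgroup of $G$ belonging to $\mathfrak{F}$. $\pi(\mathfrak{F})$ is the set of all primes dividing the order of some group in $\mathfrak{F}$; a $\pi$-group is a group all of whose order's prime divisors lie in $\pi$. The $\gamma$-series of $G$ is defined by $\gamma_{(0)}(G)=1$ and $\gamma_{(i+1)}(G)/\gamma_{(i)}(G)=\gamma(G/\gamma_{(i)}(G))$. The $\gamma$-length $h_\gamma(G)$ is the least $h\geq 0$ with $\gamma_{(h)}(G)=G$, and $h_\gamma(G)=\infty$ if there is no such $h$. *)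

theory Defs
  imports "HOL-Algebra.Algebra" "HOL-Library.Extended_Nat"
begin

text \<open>
  A class of finite groups is represented by its members carried by subsets of \<^typ>\<open>nat\<close>. As the
  class is closed under isomorphism and every finite group has a copy on \<^typ>\<open>nat\<close>, this determines
  the class; \<open>in_class\<close> is membership for groups over an arbitrary type.
\<close>

definition finite_group_class :: "nat monoid set \<Rightarrow> bool" where
  "finite_group_class F \<longleftrightarrow>
     (\<forall>G\<in>F. group G \<and> finite (carrier G)) \<and>
     (\<forall>G\<in>F. \<forall>H. group H \<and> G \<cong> H \<longrightarrow> H \<in> F)"

definition in_class :: "nat monoid set \<Rightarrow> ('a, 'b) monoid_scheme \<Rightarrow> bool" where
  "in_class F G \<longleftrightarrow> group G \<and> (\<exists>H\<in>F. G \<cong> H)"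

definition fitting_class :: "nat monoid set \<Rightarrow> bool" where
  "fitting_class F \<longleftrightarrow>
     finite_group_class F \<and> F \<noteq> {} \<and>
     (\<forall>G\<in>F. \<forall>N. N \<lhd> G \<longrightarrow> G\<lparr>carrier := N\<rparr> \<in> F) \<and>
     (\<forall>G A B. group G \<and> finite (carrier G) \<and> A \<lhd> G \<and> B \<lhd> G \<and>
        carrier G = A <#>\<^bsub>G\<^esub> B \<and> G\<lparr>carrier := A\<rparr> \<in> F \<and> G\<lparr>carrier := B\<rparr> \<in> F \<longrightarrow> G \<in> F)"

definition Q_closed :: "nat monoid set \<Rightarrow> bool" where
  "Q_closed F \<longleftrightarrow> (\<forall>G\<in>F. \<forall>H f. group H \<and> f \<in> epi G H \<longrightarrow> H \<in> F)"

definition class_radical :: "nat monoid set \<Rightarrow> ('a, 'b) monoid_scheme \<Rightarrow> 'a set" where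
  "class_radical F G = (GREATEST N. N \<lhd> G \<and> in_class F (G\<lparr>carrier := N\<rparr>))"

definition class_primes :: "nat monoid set \<Rightarrow> nat set" where
  "class_primes F = {p. Factorial_Ring.prime p \<and> (\<exists>G\<in>F. p dvd order G)}"

definition pi_group :: "nat set \<Rightarrow> ('a, 'b) monoid_scheme \<Rightarrow> bool" where
  "pi_group \<pi> G \<longleftrightarrow> group G \<and> finite (carrier G) \<and> (\<forall>p. Factorial_Ring.prime p \<and> p dvd order G \<longrightarrow> p \<in> \<pi>)"

definition maximal_subgroup :: "'a set \<Rightarrow> ('a, 'b) monoid_scheme \<Rightarrow> bool" where
  "maximal_subgroup M G \<longleftrightarrow> subgroup M G \<and> M \<noteq> carrier G \<and>
     (\<forall>K. subgroup K G \<and> M \<subseteq> K \<longrightarrow> K = M \<or> K = carrier G)"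

text \<open>
  In the \<open>\<gamma>\<close>-series, \<open>\<gamma>\<close> is only applied to quotients of \<open>G\<close>, whose elements are cosets; hence its
  type. The successor term is the full preimage in \<open>G\<close> of the subgroup that \<open>\<gamma>\<close> picks in the quotient.
\<close>

primrec gamma_series ::
  "('a set monoid \<Rightarrow> 'a set set) \<Rightarrow> ('a, 'b) monoid_scheme \<Rightarrow> nat \<Rightarrow> 'a set" where
  "gamma_series \<gamma> G 0 = {\<one>\<^bsub>G\<^esub>}"
| "gamma_series \<gamma> G (Suc i) =
     {x \<in> carrier G. gamma_series \<gamma> G i #>\<^bsub>G\<^esub> x \<in> \<gamma> (G Mod gamma_series \<gamma> G i)}"

definition gamma_length ::
  "('a set monoid \<Rightarrow> 'a set set) \<Rightarrow> ('a, 'b) monoid_scheme \<Rightarrow> enat" where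
  "gamma_length \<gamma> G =
     (if \<exists>h. gamma_series \<gamma> G h = carrier G
      then enat (LEAST h. gamma_series \<gamma> G h = carrier G) else \<infinity>)"

end

theory Submission
  imports Defs
begin

text \<open>
  Let \<open>R\<^sub>i\<close> denote the terms of the \<open>\<gamma>\<close>-series. By induction, \<open>R\<^sub>i(M) \<le> R\<^sub>i\<^sub>+\<^sub>2(G)\<close> for every \<open>i\<close>.
  If \<open>T = R\<^sub>i\<^sub>+\<^sub>2(G)\<close> is not contained in \<open>M\<close>, then \<open>G = T M\<close>, so \<open>G/T\<close> is an image of \<open>M/R\<^sub>i(M)\<close> and
  \<open>Q\<close>-closure carries \<open>R\<^sub>i\<^sub>+\<^sub>1(M)\<close> into \<open>R\<^sub>i\<^sub>+\<^sub>3(G)\<close>. If \<open>T \<le> M\<close>, then, since the series of a normal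
  subgroup is obtained by intersection, \<open>[R\<^sub>i\<^sub>+\<^sub>1(M), T] \<le> R\<^sub>i\<^sub>+\<^sub>1(M) \<inter> T = R\<^sub>i\<^sub>+\<^sub>1(T) \<le> R\<^sub>i\<^sub>+\<^sub>1(G)\<close>; so
  \<open>R\<^sub>i\<^sub>+\<^sub>1(M)\<close> centralises the radical of \<open>G/R\<^sub>i\<^sub>+\<^sub>1(G)\<close>, which in a soluble \<open>\<pi>\<close>-group contains its own
  centraliser, and \<open>R\<^sub>i\<^sub>+\<^sub>1(M) \<le> T\<close>.

  The radical contains its centraliser because \<open>F\<close> contains all cyclic \<open>p\<close>-groups for \<open>p \<in> \<pi>\<close>. These are
  obtained inductively inside wreath products of \<open>\<int>/p\<^sup>n\<close> with \<open>\<int>/p\<close>: such a \<open>p\<close>-group is generated by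
  elements whose order divides \<open>p\<^sup>n\<close>, has an element of order \<open>p\<^sup>n\<^sup>+\<^sup>1\<close>, and all its subgroups are subnormal.
\<close>

section \<open>Membership in a Fitting class and the radical\<close>

text \<open>The class \<open>F\<close> consists of groups on \<open>nat\<close>; a copy there lets
  its closure properties be applied to a finite group over any type.\<close>

lemma exists_nat_copy:
  assumes "group G" and "finite (carrier G)"
  obtains H :: "nat monoid" where "group H" and "G \<cong> H"
proof -
  interpret group G by fact
  obtain f :: "'a \<Rightarrow> nat" where f: "inj_on f (carrier G)"
    using assms(2) finite_imp_inj_to_nat_seg by blast
  show thesis
    using that[of "image_group f G"] inj_imp_image_group_is_group[OF f]
      is_isoI[OF inj_imp_image_group_iso[OF f]] by simp
qed

lemma normal_finite:
  assumes "N \<lhd> G" and "finite (carrier G)"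
  shows "finite N"
  using finite_subset[OF subgroup.subset[OF normal_imp_subgroup[OF assms(1)]] assms(2)] .

lemma group_homI: "group G \<Longrightarrow> group H \<Longrightarrow> f \<in> hom G H \<Longrightarrow> group_hom G H f"
  by (simp add: group_hom_axioms_def group_hom_def)

lemma normal_group: "N \<lhd> G \<Longrightarrow> group G"
  by (simp add: normal_def)

lemma normal_subgroup_group: "N \<lhd> G \<Longrightarrow> group (G\<lparr>carrier := N\<rparr>)"
  by (simp add: normal_def subgroup.subgroup_is_group)

lemma (in group) subset_set_mult:
  assumes "subgroup A G" and "subgroup B G"
  shows "A \<subseteq> A <#> B" and "B \<subseteq> A <#> B"
proof -
  have "a = a \<otimes> \<one>" if "a \<in> A" for a
    using that subgroup.mem_carrier[OF assms(1)] by simp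
  then show "A \<subseteq> A <#> B"
    using subgroup.one_closed[OF assms(2)] by (fastforce simp: set_mult_def)
  have "b = \<one> \<otimes> b" if "b \<in> B" for b
    using that subgroup.mem_carrier[OF assms(2)] by simp
  then show "B \<subseteq> A <#> B"
    using subgroup.one_closed[OF assms(1)] by (fastforce simp: set_mult_def)
qed

context group_hom
begin

lemma restrict_hom_epi:
  assumes "subgroup K G"
  shows "h \<in> epi (G\<lparr>carrier := K\<rparr>) (H\<lparr>carrier := h ` K\<rparr>)"
  using group_hom.homh[OF induced_group_hom[OF assms]] by (simp add: epi_def)

lemma image_normal_in_image:
  assumes "N \<lhd> G"
  shows "h ` N \<lhd> H\<lparr>carrier := h ` carrier G\<rparr>"
  using normal.surj_hom_normal_subgroup[OF assms induced_group_hom[OF G.subgroup_self, simplified]]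
  by simp

lemma vimage_normal:
  assumes "N \<lhd> H"
  shows "{x \<in> carrier G. h x \<in> N} \<lhd> G"
proof -
  interpret N: normal N H by fact
  show ?thesis
    unfolding G.normal_inv_iff
  proof (intro conjI ballI)
    show "subgroup {x \<in> carrier G. h x \<in> N} G"
    proof (rule G.subgroupI)
      show "{x \<in> carrier G. h x \<in> N} \<noteq> {}"
        using G.one_closed hom_one by fastforce
    qed auto
  qed (auto simp: N.inv_op_closed2)
qed

end

section \<open>Closure properties of the class for groups over arbitrary types\<close>

locale Q_fitting_class =
  fixes F :: "nat monoid set"
  assumes fitting: "fitting_class F" and Q_closed: "Q_closed F"
begin

lemma F_group: "H \<in> F \<Longrightarrow> group H"
  and F_finite: "H \<in> F \<Longrightarrow> finite (carrier H)"
  using fitting unfolding fitting_class_def finite_group_class_def by blast+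

lemma F_iso: "H \<in> F \<Longrightarrow> group K \<Longrightarrow> H \<cong> K \<Longrightarrow> K \<in> F"
  using fitting unfolding fitting_class_def finite_group_class_def by blast

lemma F_normal: "H \<in> F \<Longrightarrow> N \<lhd> H \<Longrightarrow> H\<lparr>carrier := N\<rparr> \<in> F"
  using fitting unfolding fitting_class_def by blast

lemma F_product:
  "group H \<Longrightarrow> finite (carrier H) \<Longrightarrow> A \<lhd> H \<Longrightarrow> B \<lhd> H \<Longrightarrow> carrier H = A <#>\<^bsub>H\<^esub> B \<Longrightarrow>
    H\<lparr>carrier := A\<rparr> \<in> F \<Longrightarrow> H\<lparr>carrier := B\<rparr> \<in> F \<Longrightarrow> H \<in> F"
  using fitting unfolding fitting_class_def by blast

lemma in_class_group: "in_class F G \<Longrightarrow> group G"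
  by (simp add: in_class_def)

lemma in_class_finite: "in_class F G \<Longrightarrow> finite (carrier G)"
  using F_finite iso_finite by (fastforce simp: in_class_def)

lemma in_class_F: "H \<in> F \<Longrightarrow> in_class F H"
  using F_group is_isoI[OF iso_set_refl, of H] by (auto simp: in_class_def intro!: bexI[of _ H])

lemma in_class_nat:
  assumes "in_class F (H :: nat monoid)"
  shows "H \<in> F"
proof -
  obtain K where "K \<in> F" "H \<cong> K" and "group H"
    using assms by (auto simp: in_class_def)
  then show ?thesis
    using F_iso group.iso_sym by blast
qed

text \<open>Q-closure speaks only of groups on \<open>nat\<close>, so the epimorphism is preceded by
  an isomorphism from a representative of \<open>G\<close> in \<open>F\<close> and followed by one
  onto a \<open>nat\<close> copy of \<open>H\<close>.\<close>

lemma in_class_epi: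
  assumes G: "in_class F G" and H: "group H" and f: "f \<in> epi G H"
  shows "in_class F H"
proof -
  obtain K where K: "K \<in> F" "G \<cong> K" and "group G"
    using G by (auto simp: in_class_def)
  then obtain g where g: "g \<in> iso K G"
    using group.iso_sym is_iso_def by blast
  have "finite (carrier H)"
    using finite_imageI[OF in_class_finite[OF G], of f] f by (simp add: epi_def)
  then obtain L :: "nat monoid" where L: "group L" "H \<cong> L"
    using exists_nat_copy H by blast
  then obtain k where k: "k \<in> iso H L"
    by (auto simp: is_iso_def)
  have "k \<circ> (f \<circ> g) \<in> epi K L"
    using f g k by (auto intro!: epi_compose simp: iso_iff_mon_epi)
  then have "L \<in> F"
    using Q_closed K L unfolding Q_closed_def by blast
  with L H show ?thesis
    by (auto simp: in_class_def)
qed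

lemma in_class_iso:
  assumes "in_class F G" and "group H" and "f \<in> iso G H"
  shows "in_class F H"
proof (rule in_class_epi[OF assms(1,2)])
  show "f \<in> epi G H"
    using assms(3) by (simp add: iso_iff_mon_epi)
qed

lemma in_class_iso_subgroup:
  assumes "group G" and "group H" and f: "f \<in> iso G H" and K: "subgroup K G"
  shows "in_class F (G\<lparr>carrier := K\<rparr>) \<longleftrightarrow> in_class F (H\<lparr>carrier := f ` K\<rparr>)"
proof -
  have iso: "restrict f K \<in> iso (G\<lparr>carrier := K\<rparr>) (H\<lparr>carrier := f ` K\<rparr>)"
    using iso_restrict[OF f assms(1,2) K] .
  have gK: "group (G\<lparr>carrier := K\<rparr>)"
    using K assms(1) by (rule subgroup.subgroup_is_group)
  have gH: "group (H\<lparr>carrier := f ` K\<rparr>)"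
    using subgroup.iso_subgroup[OF K assms(1,2) f] assms(2) by (rule subgroup.subgroup_is_group)
  show ?thesis
    using in_class_iso[OF _ gH iso] in_class_iso[OF _ gK group.iso_set_sym[OF gK iso]] by blast
qed

lemma in_class_normal:
  assumes G: "in_class F G" and N: "N \<lhd> G"
  shows "in_class F (G\<lparr>carrier := N\<rparr>)"
proof -
  obtain K where K: "K \<in> F" "G \<cong> K" and gG: "group G"
    using G by (auto simp: in_class_def)
  then obtain f where f: "f \<in> iso G K"
    by (auto simp: is_iso_def)
  have "f ` N \<lhd> K"
    using iso_normal_subgroup[OF f gG F_group[OF K(1)] N] .
  then have "K\<lparr>carrier := f ` N\<rparr> \<in> F"
    using F_normal K by blast
  then show ?thesis
    using in_class_iso_subgroup[OF gG F_group[OF K(1)] f normal_imp_subgroup[OF N]] in_class_F by blast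
qed

text \<open>Normality, products and membership of the factors are all carried by an isomorphism to a
  copy on \<open>nat\<close>, where the Fitting property applies.\<close>

lemma in_class_normal_product:
  assumes gG: "group G" and fin: "finite (carrier G)" and A: "A \<lhd> G" and B: "B \<lhd> G"
    and prod: "carrier G = A <#>\<^bsub>G\<^esub> B"
    and FA: "in_class F (G\<lparr>carrier := A\<rparr>)" and FB: "in_class F (G\<lparr>carrier := B\<rparr>)"
  shows "in_class F G"
proof -
  obtain H :: "nat monoid" where H: "group H" "G \<cong> H"
    using exists_nat_copy[OF gG fin] by blast
  then obtain f where f: "f \<in> iso G H"
    by (auto simp: is_iso_def)
  have hom: "f \<in> hom G H" and surj: "f ` carrier G = carrier H"
    using f by (auto simp: iso_iff_mon_epi epi_def)
  have sub: "A \<subseteq> carrier G" "B \<subseteq> carrier G"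
    using A B normal_imp_subgroup subgroup.subset by blast+
  have "f ` (A <#>\<^bsub>G\<^esub> B) = f ` A <#>\<^bsub>H\<^esub> f ` B"
    using sub hom by (simp add: set_mult_hom)
  moreover have "H\<lparr>carrier := f ` A\<rparr> \<in> F" "H\<lparr>carrier := f ` B\<rparr> \<in> F"
    using in_class_iso_subgroup[OF gG H(1) f normal_imp_subgroup[OF A]] FA
      in_class_iso_subgroup[OF gG H(1) f normal_imp_subgroup[OF B]] FB in_class_nat by simp_all
  moreover have "f ` A \<lhd> H" "f ` B \<lhd> H"
    using iso_normal_subgroup[OF f gG H(1) A] iso_normal_subgroup[OF f gG H(1) B] by simp_all
  moreover have "finite (carrier H)"
    using finite_imageI[OF fin, of f] surj by simp
  ultimately have "H \<in> F"
    using F_product[OF H(1), of "f ` A" "f ` B"] surj by (simp flip: prod)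
  then show ?thesis
    using gG H by (auto simp: in_class_def)
qed

text \<open>The constant map is an epimorphism from any member of the nonempty class onto the
  trivial group.\<close>

lemma in_class_trivial:
  assumes "group G"
  shows "in_class F (G\<lparr>carrier := {\<one>\<^bsub>G\<^esub>}\<rparr>)"
proof -
  obtain K where K: "K \<in> F"
    using fitting unfolding fitting_class_def by blast
  interpret K: group K
    using F_group[OF K] .
  interpret G: group G by fact
  have epi: "(\<lambda>_. \<one>\<^bsub>G\<^esub>) \<in> epi K (G\<lparr>carrier := {\<one>\<^bsub>G\<^esub>}\<rparr>)"
    using K.one_closed by (auto simp: epi_def hom_def)
  show ?thesis
    using in_class_epi[OF in_class_F[OF K] G.subgroup_imp_group[OF G.triv_subgroup] epi] .
qed

section \<open>Existence of the radical\<close>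

lemma in_class_set_mult:
  assumes fin: "finite (carrier G)" and A: "A \<lhd> G" and B: "B \<lhd> G"
    and FA: "in_class F (G\<lparr>carrier := A\<rparr>)" and FB: "in_class F (G\<lparr>carrier := B\<rparr>)"
  shows "in_class F (G\<lparr>carrier := A <#>\<^bsub>G\<^esub> B\<rparr>)"
proof -
  interpret group G
    using A by (rule normal_group)
  let ?P = "A <#>\<^bsub>G\<^esub> B"
  have P: "?P \<lhd> G"
    using A B by (rule normal_subgroup_set_mult_closed)
  have sP: "subgroup ?P G"
    using P by (rule normal_imp_subgroup)
  have "A \<subseteq> ?P" "B \<subseteq> ?P"
    using subset_set_mult[OF normal_imp_subgroup[OF A] normal_imp_subgroup[OF B]] .
  then have "A \<lhd> G\<lparr>carrier := ?P\<rparr>" "B \<lhd> G\<lparr>carrier := ?P\<rparr>"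
    using normal_restrict_supergroup[OF sP A] normal_restrict_supergroup[OF sP B] by simp_all
  moreover have "finite (carrier (G\<lparr>carrier := ?P\<rparr>))"
    using normal_finite[OF P fin] by simp
  ultimately show ?thesis
    using in_class_normal_product[of "G\<lparr>carrier := ?P\<rparr>" A B] FA FB subgroup_imp_group[OF sP] by simp
qed

text \<open>Among the normal subgroups in the class, take one of maximal cardinality. Its product
  with any other is again such a subgroup, so it cannot be larger and the other one is contained in
  it. This justifies the use of \<open>GREATEST\<close>.\<close>

lemma class_radical_greatest:
  assumes "group G" and fin: "finite (carrier G)"
  shows "class_radical F G \<lhd> G \<and> in_class F (G\<lparr>carrier := class_radical F G\<rparr>) \<and>
    (\<forall>N. N \<lhd> G \<and> in_class F (G\<lparr>carrier := N\<rparr>) \<longrightarrow> N \<subseteq> class_radical F G)"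
proof -
  interpret group G by fact
  let ?P = "\<lambda>N. N \<lhd> G \<and> in_class F (G\<lparr>carrier := N\<rparr>)"
  have triv: "?P {\<one>\<^bsub>G\<^esub>}"
    using one_is_normal in_class_trivial[OF assms(1)] by simp
  have bound: "\<forall>N. ?P N \<longrightarrow> card N < Suc (card (carrier G))"
    using card_mono[OF fin subgroup.subset[OF normal_imp_subgroup]] by (simp add: less_Suc_eq_le)
  obtain R where R: "?P R" and max: "\<And>N. ?P N \<Longrightarrow> card N \<le> card R"
    using ex_has_greatest_nat[of ?P, OF triv bound] by auto
  have greatest: "N \<subseteq> R" if N: "?P N" for N
  proof -
    have PRN: "?P (R <#>\<^bsub>G\<^esub> N)"
      using normal_subgroup_set_mult_closed[of R N] in_class_set_mult[OF fin, of R N] R N by simp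
    have sub: "R \<subseteq> R <#>\<^bsub>G\<^esub> N" "N \<subseteq> R <#>\<^bsub>G\<^esub> N"
      using subset_set_mult[of R N] R N normal_imp_subgroup[of _ G] by simp_all
    have "finite (R <#>\<^bsub>G\<^esub> N)"
      using PRN normal_finite[OF _ fin] by simp
    then have "R = R <#>\<^bsub>G\<^esub> N"
      using sub(1) max[OF PRN] by (simp add: card_seteq)
    with sub(2) show ?thesis by simp
  qed
  have "class_radical F G = R"
    unfolding class_radical_def by (rule Greatest_equality) (use R greatest in simp_all)
  with R greatest show ?thesis by simp
qed

lemma class_radical_normal: "group G \<Longrightarrow> finite (carrier G) \<Longrightarrow> class_radical F G \<lhd> G"
  by (rule class_radical_greatest[THEN conjunct1])

lemma in_class_radical:
  "group G \<Longrightarrow> finite (carrier G) \<Longrightarrow> in_class F (G\<lparr>carrier := class_radical F G\<rparr>)"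
  by (rule class_radical_greatest[THEN conjunct2, THEN conjunct1])

lemma normal_subset_class_radical:
  "finite (carrier G) \<Longrightarrow> N \<lhd> G \<Longrightarrow> in_class F (G\<lparr>carrier := N\<rparr>) \<Longrightarrow> N \<subseteq> class_radical F G"
  using class_radical_greatest[OF normal_group, of N G] by simp

end

section \<open>Subnormal subgroups and the radical series\<close>

text \<open>The chain is built downwards from the whole group, so an induction carries a property of
  the group to the subgroups below it.\<close>

inductive subnormal :: "('a, 'b) monoid_scheme \<Rightarrow> 'a set \<Rightarrow> bool" for G where
  self: "subnormal G (carrier G)"
| normal: "subnormal G K \<Longrightarrow> H \<lhd> G\<lparr>carrier := K\<rparr> \<Longrightarrow> subnormal G H"

lemma (in group) normal_imp_subnormal: "N \<lhd> G \<Longrightarrow> subnormal G N"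
  using subnormal.normal[OF subnormal.self, of N G] by simp

lemma (in group) subnormal_imp_subgroup: "subnormal G H \<Longrightarrow> subgroup H G"
proof (induction rule: subnormal.induct)
  case self
  show ?case by (rule subgroup_self)
next
  case (normal K H)
  show ?case
    using incl_subgroup[OF normal.IH normal_imp_subgroup[OF normal.hyps(2)]] .
qed

section \<open>Quotient maps and factorisation through quotients\<close>

context normal
begin

lemma group_hom_r_coset: "group_hom G (G Mod H) ((#>) H)"
  using group_homI[OF is_group factorgroup_is_group r_coset_hom_Mod] by simp

lemma finite_Mod: "finite (carrier G) \<Longrightarrow> finite (carrier (G Mod H))"
  by (simp add: carrier_FactGroup)

lemma r_coset_eq_self_iff: "x \<in> carrier G \<Longrightarrow> H #> x = H \<longleftrightarrow> x \<in> H"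
  using coset_join1[OF _ _ subgroup_axioms] coset_join2[OF _ subgroup_axioms] by auto

lemma r_coset_eq_imp:
  assumes "x \<in> carrier G" "y \<in> carrier G" "H #> x = H #> y"
  shows "x \<otimes> inv y \<in> H"
  using rcos_self[OF assms(1) subgroup_axioms] assms rcos_module[OF is_group assms(2,1)] by simp

end

lemma (in group_hom) hom_factors_through_Mod:
  assumes "N \<lhd> G" and "\<And>x. x \<in> N \<Longrightarrow> h x = \<one>\<^bsub>H\<^esub>"
  obtains g where "group_hom (G Mod N) H g" and "\<And>x. x \<in> carrier G \<Longrightarrow> g (N #> x) = h x"
proof -
  interpret N: normal N G by fact
  have const: "h x = h y" if "x \<in> carrier G" "y \<in> carrier G" "N #> x = N #> y" for x y
  proof -
    have "h x \<otimes>\<^bsub>H\<^esub> inv\<^bsub>H\<^esub> h y = \<one>\<^bsub>H\<^esub>"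
      using assms(2)[OF N.r_coset_eq_imp[OF that]] that by simp
    then show ?thesis
      using that H.inv_equality[of "h x" "inv\<^bsub>H\<^esub> h y"] by simp
  qed
  show thesis
  proof (rule FactGroup_universal[OF homh assms(1)])
    fix g assume "g \<in> hom (G Mod N) H" and "\<And>x. x \<in> carrier G \<Longrightarrow> g (N #> x) = h x"
    then show thesis
      by (intro that[OF group_homI[OF N.factorgroup_is_group H.is_group]])
  qed (rule const)
qed

section \<open>The radical under subnormality and homomorphisms\<close>

context Q_fitting_class
begin

lemma in_class_image:
  assumes "group_hom G H h" and "subgroup K G" and "in_class F (G\<lparr>carrier := K\<rparr>)"
  shows "in_class F (H\<lparr>carrier := h ` K\<rparr>)"
proof -
  interpret group_hom G H h by fact
  show ?thesis
    using in_class_epi[OF assms(3) H.subgroup_imp_group[OF subgroup_img_is_subgroup[OF assms(2)]]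
        restrict_hom_epi[OF assms(2)]] .
qed

text \<open>Conjugation by an element of \<open>G\<close> is an automorphism of \<open>N\<close>, so
  it sends the radical of \<open>N\<close> to a normal subgroup of \<open>N\<close> in the class,
  which lies in the radical again.\<close>

lemma class_radical_of_normal:
  assumes N: "N \<lhd> G" and fin: "finite (carrier G)"
  shows "class_radical F (G\<lparr>carrier := N\<rparr>) \<lhd> G"
proof -
  interpret N: normal N G by fact
  let ?N = "G\<lparr>carrier := N\<rparr>"
  define R where "R = class_radical F ?N"
  have gN: "group ?N"
    using N by (rule normal_subgroup_group)
  have finN: "finite (carrier ?N)"
    using normal_finite[OF N fin] by simp
  have R: "R \<lhd> ?N" and FR: "in_class F (?N\<lparr>carrier := R\<rparr>)"
    unfolding R_def using class_radical_normal[OF gN finN] in_class_radical[OF gN finN] .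
  have "x \<otimes>\<^bsub>G\<^esub> r \<otimes>\<^bsub>G\<^esub> inv\<^bsub>G\<^esub> x \<in> R" if x: "x \<in> carrier G" and r: "r \<in> R" for x r
  proof -
    let ?c = "\<lambda>n. x \<otimes>\<^bsub>G\<^esub> n \<otimes>\<^bsub>G\<^esub> inv\<^bsub>G\<^esub> x"
    have "?c \<in> hom ?N ?N"
    proof (rule homI)
      fix m n assume mn: "m \<in> carrier ?N" "n \<in> carrier ?N"
      show "?c n \<in> carrier ?N"
        using mn N.inv_op_closed2[OF x] by simp
      show "?c (m \<otimes>\<^bsub>?N\<^esub> n) = ?c m \<otimes>\<^bsub>?N\<^esub> ?c n"
        using mn x by (simp add: N.m_assoc N.inv_solve_left)
    qed
    then interpret c: group_hom ?N ?N ?c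
      using gN by (intro group_homI)
    have "?c ` N = N"
    proof
      show "?c ` N \<subseteq> N"
        using N.inv_op_closed2[OF x] by auto
      show "N \<subseteq> ?c ` N"
      proof
        fix n assume n: "n \<in> N"
        have "n = ?c (inv\<^bsub>G\<^esub> x \<otimes>\<^bsub>G\<^esub> n \<otimes>\<^bsub>G\<^esub> x)"
          using x n by (simp add: N.m_assoc flip: N.m_assoc[of x "inv\<^bsub>G\<^esub> x"])
        then show "n \<in> ?c ` N"
          using N.inv_op_closed1[OF x n] by (rule image_eqI)
      qed
    qed
    then have "?c ` R \<lhd> ?N"
      using c.image_normal_in_image[OF R] by simp
    moreover have "in_class F (?N\<lparr>carrier := ?c ` R\<rparr>)"
      using in_class_image[OF c.group_hom_axioms normal_imp_subgroup[OF R] FR] .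
    ultimately have "?c ` R \<subseteq> R"
      using normal_subset_class_radical[OF finN] by (simp add: R_def)
    with r show ?thesis by blast
  qed
  moreover have "subgroup R G"
    using N.incl_subgroup[OF N.subgroup_axioms normal_imp_subgroup[OF R]] .
  ultimately show ?thesis
    by (simp add: N.normal_inv_iff R_def)
qed

lemma in_class_subnormal:
  assumes "in_class F G" and "subnormal G H"
  shows "in_class F (G\<lparr>carrier := H\<rparr>)"
  using assms(2)
proof (induction rule: subnormal.induct)
  case self
  then show ?case using assms(1) by simp
next
  case (normal K H)
  then show ?case using in_class_normal[OF normal.IH normal.hyps(2)] by simp
qed

text \<open>At each link of the chain the radical of the smaller group is normal in the larger one
  by \<open>class_radical_of_normal\<close>, and it is in the class, so the larger radical contains
  it.\<close>

lemma class_radical_subnormal: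
  assumes "group G" and fin: "finite (carrier G)" and "subnormal G H"
  shows "class_radical F (G\<lparr>carrier := H\<rparr>) \<subseteq> class_radical F G"
  using assms(3)
proof (induction rule: subnormal.induct)
  case self
  then show ?case by simp
next
  case (normal K H)
  interpret group G by fact
  let ?K = "G\<lparr>carrier := K\<rparr>"
  have sK: "subgroup K G"
    using normal.hyps(1) by (rule subnormal_imp_subgroup)
  have fK: "finite (carrier ?K)"
    using finite_subset[OF subgroup.subset[OF sK] fin] by simp
  have fH: "finite (carrier (?K\<lparr>carrier := H\<rparr>))"
    using normal_finite[OF normal.hyps(2) fK] by simp
  have "class_radical F (?K\<lparr>carrier := H\<rparr>) \<subseteq> class_radical F ?K"
    using normal_subset_class_radical[OF fK class_radical_of_normal[OF normal.hyps(2) fK]]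
      in_class_radical[OF normal_subgroup_group[OF normal.hyps(2)] fH] by simp
  then show ?case
    using normal.IH by simp
qed

lemma subnormal_subset_class_radical:
  assumes "group G" and fin: "finite (carrier G)" and "subnormal G H"
    and FH: "in_class F (G\<lparr>carrier := H\<rparr>)"
  shows "H \<subseteq> class_radical F G"
proof -
  have "H \<subseteq> class_radical F (G\<lparr>carrier := H\<rparr>)"
    using normal_subset_class_radical[OF in_class_finite[OF FH]
        group.normal_self[OF in_class_group[OF FH]]] FH by simp
  then show ?thesis
    using class_radical_subnormal[OF assms(1-3)] by simp
qed

text \<open>The image of the radical is normal in the image of \<open>G\<close>, hence subnormal in
  \<open>H\<close>, and Q-closure keeps it in the class.\<close>

lemma class_radical_hom_normal_image:
  assumes hom: "group_hom G H h" and finG: "finite (carrier G)" and finH: "finite (carrier H)"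
    and im: "h ` carrier G \<lhd> H" and x: "x \<in> class_radical F G"
  shows "h x \<in> class_radical F H"
proof -
  interpret group_hom G H h by fact
  let ?R = "class_radical F G"
  have R: "?R \<lhd> G"
    using class_radical_normal[OF G.is_group finG] .
  have "subnormal H (h ` ?R)"
    using subnormal.normal[OF H.normal_imp_subnormal[OF im] image_normal_in_image[OF R]] .
  moreover have "in_class F (H\<lparr>carrier := h ` ?R\<rparr>)"
    using in_class_image[OF hom normal_imp_subgroup[OF R] in_class_radical[OF G.is_group finG]] .
  ultimately have "h ` ?R \<subseteq> class_radical F H"
    using subnormal_subset_class_radical[OF H.is_group finH] by simp
  with x show ?thesis by blast
qed

text \<open>The intersection of the image of \<open>G\<close> with the radical of \<open>H\<close>
  is normal in that radical, hence in the class; the isomorphism of \<open>G\<close> with its image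
  pulls this back to a normal subgroup of \<open>G\<close>.\<close>

lemma class_radical_inj_vimage:
  assumes hom: "group_hom G H h" and finG: "finite (carrier G)" and finH: "finite (carrier H)"
    and im: "h ` carrier G \<lhd> H" and inj: "inj_on h (carrier G)"
    and x: "x \<in> carrier G" and hx: "h x \<in> class_radical F H"
  shows "x \<in> class_radical F G"
proof -
  interpret group_hom G H h by fact
  let ?R = "class_radical F H" and ?I = "H\<lparr>carrier := h ` carrier G\<rparr>"
  have R: "?R \<lhd> H"
    using class_radical_normal[OF H.is_group finH] .
  define A where "A = {x \<in> carrier G. h x \<in> ?R}"
  have A: "A \<lhd> G"
    unfolding A_def using R by (rule vimage_normal)
  have hA: "h ` A = h ` carrier G \<inter> ?R"
    by (auto simp: A_def)
  have "h ` A \<lhd> H\<lparr>carrier := ?R\<rparr>"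
    unfolding hA using H.normal_Int_subgroup[OF normal_imp_subgroup[OF R] im] .
  then have "in_class F (?I\<lparr>carrier := h ` A\<rparr>)"
    using in_class_normal[OF in_class_radical[OF H.is_group finH]] by simp
  moreover have "h \<in> iso G ?I"
    using inj restrict_hom_epi[OF G.subgroup_self] by (simp add: iso_iff_mon_epi epi_def mon_def)
  ultimately have "in_class F (G\<lparr>carrier := A\<rparr>)"
    using in_class_iso_subgroup[OF G.is_group normal_subgroup_group[OF im] _ normal_imp_subgroup[OF A]]
    by simp
  then show ?thesis
    using normal_subset_class_radical[OF finG A] x hx by (auto simp: A_def)
qed

text \<open>The map factors through \<open>G Mod N\<close> as soon as it kills \<open>N\<close>.
  This and the converse below compare successive series terms of different groups.\<close>

lemma class_radical_Mod_hom:
  assumes hom: "group_hom G H h" and finG: "finite (carrier G)" and finH: "finite (carrier H)"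
    and N: "N \<lhd> G" and ker: "\<And>y. y \<in> N \<Longrightarrow> h y = \<one>\<^bsub>H\<^esub>" and im: "h ` carrier G \<lhd> H"
    and x: "x \<in> carrier G" and Nx: "N #>\<^bsub>G\<^esub> x \<in> class_radical F (G Mod N)"
  shows "h x \<in> class_radical F H"
proof -
  interpret group_hom G H h by fact
  obtain g where g: "group_hom (G Mod N) H g" "\<And>x. x \<in> carrier G \<Longrightarrow> g (N #>\<^bsub>G\<^esub> x) = h x"
    by (rule hom_factors_through_Mod[OF N]) (rule ker, assumption, rule that)
  have "g ` carrier (G Mod N) = h ` carrier G"
    using g(2) by (simp add: carrier_FactGroup image_image)
  then have "g (N #>\<^bsub>G\<^esub> x) \<in> class_radical F H"
    using class_radical_hom_normal_image[OF g(1) normal.finite_Mod[OF N finG] finH _ Nx] im by simp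
  then show ?thesis
    using g(2) x by simp
qed

text \<open>Here \<open>N\<close> is the exact kernel, so the induced map on the quotient is
  injective.\<close>

lemma class_radical_Mod_vimage:
  assumes hom: "group_hom G H h" and finG: "finite (carrier G)" and finH: "finite (carrier H)"
    and N: "N \<lhd> G" and ker: "\<And>y. y \<in> carrier G \<Longrightarrow> h y = \<one>\<^bsub>H\<^esub> \<longleftrightarrow> y \<in> N"
    and im: "h ` carrier G \<lhd> H"
    and x: "x \<in> carrier G" and hx: "h x \<in> class_radical F H"
  shows "N #>\<^bsub>G\<^esub> x \<in> class_radical F (G Mod N)"
proof -
  interpret group_hom G H h by fact
  interpret N: normal N G by fact
  obtain g where g: "group_hom (G Mod N) H g" "\<And>x. x \<in> carrier G \<Longrightarrow> g (N #>\<^bsub>G\<^esub> x) = h x"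
    by (rule hom_factors_through_Mod[OF N]) (rule ker[THEN iffD2], simp_all add: that)
  interpret g: group_hom "G Mod N" H g by fact
  have "g ` carrier (G Mod N) = h ` carrier G"
    using g(2) by (simp add: carrier_FactGroup image_image)
  moreover have "\<forall>U\<in>carrier (G Mod N). g U = \<one>\<^bsub>H\<^esub> \<longrightarrow> U = \<one>\<^bsub>G Mod N\<^esub>"
    unfolding carrier_FactGroup by (simp add: g(2) ker N.r_coset_eq_self_iff)
  then have "inj_on g (carrier (G Mod N))"
    by (simp add: g.inj_on_one_iff)
  moreover have "N #>\<^bsub>G\<^esub> x \<in> carrier (G Mod N)"
    using x by (auto simp: carrier_FactGroup)
  moreover have "g (N #>\<^bsub>G\<^esub> x) \<in> class_radical F H"
    using g(2) x hx by simp
  ultimately show ?thesis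
    using class_radical_inj_vimage[OF g(1) N.finite_Mod[OF finG] finH] im by simp
qed

section \<open>The radical series and normal subgroups\<close>

abbreviation radical_series :: "('a, 'b) monoid_scheme \<Rightarrow> nat \<Rightarrow> 'a set" where
  "radical_series \<equiv> gamma_series (class_radical F)"

lemma radical_series_normal:
  assumes "group G" and fin: "finite (carrier G)"
  shows "radical_series G i \<lhd> G"
proof (induction i)
  case 0
  then show ?case using group.one_is_normal[OF assms(1)] by simp
next
  case (Suc i)
  interpret normal "radical_series G i" G by (rule Suc.IH)
  show ?case
    using group_hom.vimage_normal[OF group_hom_r_coset
        class_radical_normal[OF factorgroup_is_group finite_Mod[OF fin]]] by simp
qed

lemma radical_series_Suc_mono:
  assumes "group G" and fin: "finite (carrier G)"
  shows "radical_series G i \<subseteq> radical_series G (Suc i)"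
proof
  interpret normal "radical_series G i" G
    using radical_series_normal[OF assms] .
  fix x assume x: "x \<in> radical_series G i"
  have "\<one>\<^bsub>G Mod radical_series G i\<^esub> \<in> class_radical F (G Mod radical_series G i)"
    using subgroup.one_closed[OF normal_imp_subgroup[OF
        class_radical_normal[OF factorgroup_is_group finite_Mod[OF fin]]]] .
  then show "x \<in> radical_series G (Suc i)"
    using x r_coset_eq_self_iff[of x] by simp
qed

lemma radical_series_mono:
  assumes "group G" and "finite (carrier G)" and "i \<le> j"
  shows "radical_series G i \<subseteq> radical_series G j"
  using lift_Suc_mono_le[of "radical_series G", OF radical_series_Suc_mono[OF assms(1,2)] assms(3)] .

text \<open>Modulo its intersection with the \<open>i\<close>-th term of \<open>G\<close>, the group
  \<open>N\<close> embeds as a normal subgroup of the quotient of \<open>G\<close> by that term. The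
  radical of a normal subgroup is its intersection with the whole radical, and this gives the next
  term.\<close>

lemma radical_series_of_normal:
  assumes N: "N \<lhd> G" and fin: "finite (carrier G)"
  shows "radical_series (G\<lparr>carrier := N\<rparr>) i = N \<inter> radical_series G i"
proof (induction i)
  case 0
  show ?case
    using subgroup.one_closed[OF normal_imp_subgroup[OF N]] by auto
next
  case (Suc i)
  let ?N = "G\<lparr>carrier := N\<rparr>"
  interpret N: normal N G by fact
  interpret R: normal "radical_series G i" G
    using radical_series_normal[OF N.is_group fin] .
  let ?R = "radical_series G i"
  interpret pr: group_hom G "G Mod ?R" "(#>\<^bsub>G\<^esub>) ?R"
    by (rule R.group_hom_r_coset)
  have gN: "group ?N"
    using N by (rule normal_subgroup_group)
  have finN: "finite (carrier ?N)"
    using normal_finite[OF N fin] by simp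
  have K: "N \<inter> ?R \<lhd> ?N"
    using radical_series_normal[OF gN finN, of i] Suc.IH by simp
  have hom: "group_hom ?N (G Mod ?R) ((#>\<^bsub>G\<^esub>) ?R)"
  proof (rule group_homI[OF gN R.factorgroup_is_group])
    show "(#>\<^bsub>G\<^esub>) ?R \<in> hom ?N (G Mod ?R)"
      using pr.hom_mult by (intro homI) (simp_all add: N.m_closed)
  qed
  have ker: "?R #>\<^bsub>G\<^esub> y = \<one>\<^bsub>G Mod ?R\<^esub> \<longleftrightarrow> y \<in> N \<inter> ?R" if "y \<in> carrier ?N" for y
    using that R.r_coset_eq_self_iff[of y] by simp
  have "(#>\<^bsub>G\<^esub>) ?R ` carrier G = carrier (G Mod ?R)"
    by (simp add: carrier_FactGroup)
  then have im: "(#>\<^bsub>G\<^esub>) ?R ` carrier ?N \<lhd> G Mod ?R"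
    using N.surj_hom_normal_subgroup[OF pr.group_hom_axioms] by simp
  have "(N \<inter> ?R) #>\<^bsub>?N\<^esub> x \<in> class_radical F (?N Mod (N \<inter> ?R)) \<longleftrightarrow>
      ?R #>\<^bsub>G\<^esub> x \<in> class_radical F (G Mod ?R)" if "x \<in> N" for x
    using class_radical_Mod_hom[OF hom finN R.finite_Mod[OF fin] K _ im, of x]
      class_radical_Mod_vimage[OF hom finN R.finite_Mod[OF fin] K ker im, of x] ker that
    by auto
  then show ?case
    by (auto simp: Suc.IH)
qed

end

section \<open>Subgroups of p-groups and cyclic groups\<close>

text \<open>Orbit sizes are powers of \<open>p\<close>. If the given point were the only fixed
  point, all other orbits would have size divisible by \<open>p\<close>, and \<open>card E\<close>
  would be 1 modulo \<open>p\<close>.\<close>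

lemma (in group_action) p_group_second_fixed_point:
  assumes p: "Factorial_Ring.prime p" and ord: "order G = p ^ b" and fin: "finite E"
    and dvd: "p dvd card E" and x0: "x\<^sub>0 \<in> E" "\<forall>g\<in>carrier G. \<phi> g x\<^sub>0 = x\<^sub>0"
  shows "\<exists>x\<in>E. x \<noteq> x\<^sub>0 \<and> (\<forall>g\<in>carrier G. \<phi> g x = x)"
proof (rule ccontr)
  assume "\<not> ?thesis"
  then have unique: "x = x\<^sub>0" if "x \<in> E" "\<forall>g\<in>carrier G. \<phi> g x = x" for x
    using that by blast
  interpret group G
    using group_hom group_hom.axioms(1) by blast
  have orb0: "orbit G \<phi> x\<^sub>0 = {x\<^sub>0}"
    using x0(2) one_closed unfolding orbit_def by force
  then have mem0: "{x\<^sub>0} \<in> orbits G E \<phi>"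
    using x0(1) by (auto simp: orbits_def)
  have finO: "finite (orbits G E \<phi>)"
    using fin by (simp add: orbits_def)
  have "p dvd card Orb" if Orb: "Orb \<in> orbits G E \<phi> - {{x\<^sub>0}}" for Orb
  proof -
    obtain x where x: "x \<in> E" "Orb = orbit G \<phi> x"
      using Orb by (auto simp: orbits_def)
    have "card Orb dvd p ^ b"
      using orbit_stabilizer_theorem[OF x(1)] ord x(2) dvd_triv_left by metis
    then obtain k where k: "card Orb = p ^ k"
      using divides_primepow_nat[OF p] by blast
    have "k \<noteq> 0"
    proof
      assume "k = 0"
      then obtain y where y: "Orb = {y}"
        using k by (auto simp: card_1_singleton_iff)
      have mem: "\<phi> g x \<in> Orb" if "g \<in> carrier G" for g
        using that x(2) by (auto simp: orbit_def)
      have "\<phi> \<one> x = x"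
        using x(1) id_eq_one by (metis restrict_apply')
      then have "x = y"
        using mem[OF one_closed] y by simp
      then have "x = x\<^sub>0"
        using unique[OF x(1)] mem y by simp
      with orb0 x(2) Orb show False by simp
    qed
    with k show ?thesis by (simp add: dvd_power)
  qed
  then have "p dvd (\<Sum>Orb\<in>orbits G E \<phi> - {{x\<^sub>0}}. card Orb)"
    by (rule dvd_sum)
  moreover have "card E = 1 + (\<Sum>Orb\<in>orbits G E \<phi> - {{x\<^sub>0}}. card Orb)"
    using disjoint_sum[OF fin, of "\<lambda>_. 1::nat"] sum.remove[OF finO mem0, of card] by simp
  ultimately have "p dvd 1"
    using dvd dvd_add_left_iff by metis
  then show False
    using prime_gt_1_nat[OF p] by simp
qed

text \<open>The inverse turns right translation into a left action; the restriction to the set of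
  cosets is there because \<open>Bij\<close> consists of extensional maps.\<close>

lemma (in group) action_on_rcosets:
  assumes H: "subgroup H G"
  shows "group_action (G\<lparr>carrier := H\<rparr>) (rcosets H) (\<lambda>h. \<lambda>U\<in>rcosets H. U #> inv h)"
    (is "group_action ?H ?E ?\<phi>")
proof -
  interpret H: subgroup H G by fact
  have closed: "U #> inv h \<in> ?E" if "U \<in> ?E" "h \<in> H" for U h
  proof -
    have "\<exists>x\<in>carrier G. U = H #> x"
      using that(1) by (simp add: RCOSETS_def)
    then obtain x where x: "x \<in> carrier G" "U = H #> x" ..
    then have "U #> inv h = H #> (x \<otimes> inv h)"
      using that(2) by (simp add: coset_mult_assoc H.subset)
    then show ?thesis
      using x(1) that(2) H.mem_carrier rcosetsI[OF H.subset] by simp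
  qed
  have sub: "U \<subseteq> carrier G" if "U \<in> ?E" for U
    using that H.rcosets_carrier[OF is_group] by blast
  have bij: "?\<phi> h \<in> Bij ?E" if h: "h \<in> H" for h
  proof -
    have "bij_betw (?\<phi> h) ?E ?E"
      by (rule bij_betw_byWitness[where f' = "\<lambda>U. U #> h"])
        (use h closed closed[OF _ H.m_inv_closed[OF h]] sub in \<open>auto simp: coset_mult_assoc\<close>)
    then show ?thesis
      by (simp add: Bij_def)
  qed
  have "?\<phi> \<in> hom ?H (BijGroup ?E)"
  proof (rule homI)
    fix g h assume gh: "g \<in> carrier ?H" "h \<in> carrier ?H"
    show "?\<phi> h \<in> carrier (BijGroup ?E)"
      using bij gh by (simp add: BijGroup_def)
    have "?\<phi> (g \<otimes> h) = compose ?E (?\<phi> g) (?\<phi> h)"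
      unfolding compose_def using gh
      by (intro restrict_ext) (simp add: closed sub coset_mult_assoc inv_mult_group)
    then show "?\<phi> (g \<otimes>\<^bsub>?H\<^esub> h) = ?\<phi> g \<otimes>\<^bsub>BijGroup ?E\<^esub> ?\<phi> h"
      using bij gh by (simp add: BijGroup_def)
  qed
  then show ?thesis
    by (intro group_action.intro group_homI H.subgroup_is_group is_group group_BijGroup)
qed

text \<open>\<open>H\<close> acts by right translation on its right cosets, whose number is
  divisible by \<open>p\<close>, and fixes the coset \<open>H\<close>. So it fixes a second coset
  \<open>H #> x\<close>, which means that \<open>x\<close> normalises \<open>H\<close>.\<close>

lemma (in group) p_group_normalizer_grows:
  assumes p: "Factorial_Ring.prime p" and ord: "order G = p ^ a"
    and H: "subgroup H G" and proper: "H \<noteq> carrier G"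
  shows "H \<subset> normalizer G H"
proof -
  interpret H: subgroup H G by fact
  interpret act: group_action "G\<lparr>carrier := H\<rparr>" "rcosets H" "\<lambda>h. \<lambda>U\<in>rcosets H. U #> inv h"
    using H by (rule action_on_rcosets)
  have "order G > 0"
    using ord p by (simp add: prime_gt_0_nat)
  then have fin: "finite (carrier G)"
    using order_gt_0_iff_finite by simp
  have finH: "finite H"
    using finite_subset[OF H.subset fin] .
  have lag: "card (rcosets H) * card H = p ^ a"
    using lagrange[OF H] ord by simp
  then obtain b c where b: "card H = p ^ b" and c: "card (rcosets H) = p ^ c"
    using divides_primepow_nat[OF p] by (metis dvd_triv_left dvd_triv_right)
  have "c \<noteq> 0"
  proof
    assume "c = 0"
    then have "card H = card (carrier G)"
      using lag c ord by (simp add: order_def)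
    then show False
      using card_subset_eq[OF fin H.subset] proper by simp
  qed
  then have "p dvd card (rcosets H)"
    using c by (simp add: dvd_power)
  moreover have "H \<in> rcosets H"
    using H.subgroup_in_rcosets[OF is_group] .
  moreover have "\<forall>h\<in>carrier (G\<lparr>carrier := H\<rparr>). (\<lambda>U\<in>rcosets H. U #> inv h) H = H"
    using calculation(2) by (simp add: coset_join2[OF _ H])
  ultimately obtain U where U: "U \<in> rcosets H" "U \<noteq> H"
    and fixU: "\<forall>h\<in>H. U #> inv h = U"
    using act.p_group_second_fixed_point[OF p, of b H] b rcosets_finite[OF _ H.subset finH]
      finite_subset[OF rcosets_subset_PowG[OF H]] fin
    by (auto simp: order_def)
  have "\<exists>x\<in>carrier G. U = H #> x"
    using U(1) by (simp add: RCOSETS_def)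
  then obtain x where x: "x \<in> carrier G" and Ux: "U = H #> x" ..
  have "x \<notin> H"
    using U(2) Ux coset_join2[OF x H] by blast
  have conj: "x \<otimes> h \<otimes> inv x \<in> H" if h: "h \<in> H" for h
  proof -
    have "U #> h = U"
      using bspec[OF fixU H.m_inv_closed[OF h]] h by simp
    then have "H #> (x \<otimes> h) = H #> x"
      using Ux x h by (simp add: coset_mult_assoc H.subset)
    then have "x \<otimes> h \<in> H #> x"
      using rcos_self[OF _ H, of "x \<otimes> h"] x h by simp
    then show ?thesis
      using H.rcos_module[OF is_group x, of "x \<otimes> h"] x h by simp
  qed
  have eq: "x <# H #> inv x = (\<lambda>h. x \<otimes> h \<otimes> inv x) ` H"
    by (auto simp: l_coset_def r_coset_def)
  \<comment> \<open>Conjugation by \<open>x\<close> maps the finite set \<open>H\<close> injectively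
    into itself, hence onto itself.\<close>
  have "inj_on (\<lambda>h. x \<otimes> h \<otimes> inv x) H"
    using x by (auto intro!: inj_onI)
  then have "x <# H #> inv x = H"
    unfolding eq using conj by (intro card_subset_eq finH) (auto simp: card_image)
  then have "x \<in> normalizer G H"
    using x H.subset by (simp add: normalizer_def stabilizer_def)
  moreover have "H \<subseteq> normalizer G H"
    using normal_imp_subgroup[OF subgroup_in_normalizer[OF H]] subgroup.subset by force
  ultimately show ?thesis
    using \<open>x \<notin> H\<close> by blast
qed

text \<open>Climb through normalisers: the normaliser of a proper subgroup is strictly larger, so
  the induction reaches the whole group.\<close>

lemma (in group) p_group_subgroup_subnormal:
  assumes p: "Factorial_Ring.prime p" and ord: "order G = p ^ a" and H: "subgroup H G"
  shows "subnormal G H"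
  using H
proof (induction "card (carrier G) - card H" arbitrary: H rule: less_induct)
  case less
  show ?case
  proof (cases "H = carrier G")
    case True
    then show ?thesis by (simp add: subnormal.self)
  next
    case False
    let ?N = "normalizer G H"
    have fin: "finite (carrier G)"
      using ord p order_gt_0_iff_finite by (simp add: prime_gt_0_nat)
    have N: "subgroup ?N G"
      using normalizer_imp_subgroup[OF subgroup.subset[OF less.prems]] .
    have grow: "H \<subset> ?N"
      using p_group_normalizer_grows[OF p ord less.prems False] .
    have "card H < card ?N"
      using psubset_card_mono[OF finite_subset[OF subgroup.subset[OF N] fin] grow] .
    moreover have "card ?N \<le> card (carrier G)"
      using card_mono[OF fin subgroup.subset[OF N]] .
    ultimately have "subnormal G ?N"
      using less.hyps[OF _ N] by simp
    then show ?thesis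
      using subgroup_in_normalizer[OF less.prems] by (rule subnormal.normal)
  qed
qed

section \<open>Cyclic subgroups as residue class groups\<close>

lemma (in group) int_pow_iso_integer_mod_group:
  assumes x: "x \<in> carrier G"
  shows "(\<lambda>k::int. x [^] k) \<in> iso (integer_mod_group (ord x)) (G\<lparr>carrier := generate G {x}\<rparr>)"
proof (rule isoI)
  let ?n = "ord x" and ?Z = "integer_mod_group (ord x)"
  have mod: "x [^] (k mod int ?n) = x [^] k" for k :: int
    using int_pow_eq[OF x] by (simp add: mod_eq_dvd_iff flip: mod_eq_dvd_iff)
  have gen: "generate G {x} = range (\<lambda>k::int. x [^] k)"
    using generate_pow[OF x] by auto
  show "(\<lambda>k. x [^] k) \<in> hom ?Z (G\<lparr>carrier := generate G {x}\<rparr>)"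
    by (rule homI) (simp_all add: gen mod int_pow_mult x)
  have "inj_on (\<lambda>k. x [^] k) (carrier ?Z)"
  proof (rule inj_onI)
    fix j k assume "j \<in> carrier ?Z" "k \<in> carrier ?Z" "x [^] j = x [^] k"
    then show "j = k"
      using int_pow_eq[OF x, of j k] zdvd_imp_le[of "int ?n" "k - j"] zdvd_imp_le[of "int ?n" "j - k"]
      by (cases j k rule: linorder_cases) (auto simp: carrier_integer_mod_group dvd_diff_commute split: if_splits)
  qed
  moreover have "(\<lambda>k. x [^] k) ` carrier ?Z = generate G {x}"
  proof
    show "generate G {x} \<subseteq> (\<lambda>k. x [^] k) ` carrier ?Z"
    proof
      fix y assume "y \<in> generate G {x}"
      then obtain k :: int where "y = x [^] (k mod int ?n)"
        using gen mod by auto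
      then show "y \<in> (\<lambda>k. x [^] k) ` carrier ?Z"
        \<comment> \<open>An element of infinite order has \<open>ord\<close> 0; then
          \<open>?Z\<close> is the group of all integers and reduction modulo 0 is the
          identity.\<close>
        by (cases "?n = 0") (auto simp: carrier_integer_mod_group)
    qed
  qed (auto simp: gen)
  ultimately show "bij_betw (\<lambda>k. x [^] k) (carrier ?Z) (carrier (G\<lparr>carrier := generate G {x}\<rparr>))"
    by (simp add: bij_betw_def)
qed

lemma (in Q_fitting_class) in_class_generate_iff:
  assumes "group G" and x: "x \<in> carrier G"
  shows "in_class F (G\<lparr>carrier := generate G {x}\<rparr>) \<longleftrightarrow>
    in_class F (integer_mod_group (group.ord G x))"
proof -
  interpret group G by fact
  have iso: "(\<lambda>k::int. x [^]\<^bsub>G\<^esub> k) \<in> iso (integer_mod_group (ord x)) (G\<lparr>carrier := generate G {x}\<rparr>)"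
    using x by (rule int_pow_iso_integer_mod_group)
  have gr: "group (G\<lparr>carrier := generate G {x}\<rparr>)"
    using x by (intro subgroup_imp_group generate_is_subgroup) simp
  show ?thesis
    using in_class_iso[OF _ gr iso]
      in_class_iso[OF _ group_integer_mod_group group.iso_set_sym[OF group_integer_mod_group iso]]
    by (rule iffI[rotated])
qed

section \<open>Cyclic p-groups in a Fitting class\<close>

text \<open>The pair \<open>(f, s)\<close> is the element of the base group \<open>f\<close> followed by the rotation of the coordinates by \<open>s\<close>.\<close>

definition cyclic_wreath :: "int \<Rightarrow> int \<Rightarrow> ((int \<Rightarrow> int) \<times> int) monoid" where
  "cyclic_wreath q p =
    \<lparr>carrier = ({0..<p} \<rightarrow>\<^sub>E {0..<q}) \<times> {0..<p},
     monoid.mult = (\<lambda>(f, s) (g, t). (\<lambda>i\<in>{0..<p}. (f i + g ((i + s) mod p)) mod q, (s + t) mod p)),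
     one = (\<lambda>i\<in>{0..<p}. 0, 0)\<rparr>"

section \<open>Wreath products of cyclic groups\<close>

context
  fixes q p :: int
  assumes q: "q > 0" and p: "p > 0"
begin

lemma cyclic_wreath_group: "group (cyclic_wreath q p)"
proof (rule groupI)
  let ?W = "cyclic_wreath q p"
  show "\<one>\<^bsub>?W\<^esub> \<in> carrier ?W"
    using q p by (auto simp: cyclic_wreath_def)
  show "x \<otimes>\<^bsub>?W\<^esub> y \<in> carrier ?W" if "x \<in> carrier ?W" "y \<in> carrier ?W" for x y
    using q p that by (auto simp: cyclic_wreath_def)
  show "x \<otimes>\<^bsub>?W\<^esub> y \<otimes>\<^bsub>?W\<^esub> z = x \<otimes>\<^bsub>?W\<^esub> (y \<otimes>\<^bsub>?W\<^esub> z)"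
    if "x \<in> carrier ?W" "y \<in> carrier ?W" "z \<in> carrier ?W" for x y z
    using q p that by (auto simp: cyclic_wreath_def mod_simps ac_simps intro!: restrict_ext)
  show "\<one>\<^bsub>?W\<^esub> \<otimes>\<^bsub>?W\<^esub> x = x" if "x \<in> carrier ?W" for x
  proof -
    obtain f s where x: "x = (f, s)" by (cases x)
    have "(\<lambda>i\<in>{0..<p}. f (i mod p) mod q) = f"
    proof
      fix i show "(\<lambda>i\<in>{0..<p}. f (i mod p) mod q) i = f i"
        using that x by (cases "i \<in> {0..<p}") (auto simp: cyclic_wreath_def PiE_def Pi_def extensional_def)
    qed
    then show ?thesis
      using that x by (simp add: cyclic_wreath_def cong: restrict_cong)
  qed
  show "\<exists>y\<in>carrier ?W. y \<otimes>\<^bsub>?W\<^esub> x = \<one>\<^bsub>?W\<^esub>" if "x \<in> carrier ?W" for x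
  proof -
    obtain f s where x: "x = (f, s)" by (cases x)
    \<comment> \<open>For a left inverse, the first component at \<open>i\<close> must cancel the
      value of \<open>f\<close> at the coordinate reached from \<open>i\<close> by the rotation by
      \<open>- s\<close>.\<close>
    let ?y = "(\<lambda>i\<in>{0..<p}. (- f ((i - s) mod p)) mod q, (- s) mod p)"
    have "?y \<in> carrier ?W"
      using q p by (auto simp: cyclic_wreath_def)
    moreover have "?y \<otimes>\<^bsub>?W\<^esub> x = \<one>\<^bsub>?W\<^esub>"
      using x by (auto simp: cyclic_wreath_def mod_simps intro!: restrict_ext)
    ultimately show ?thesis by blast
  qed
qed

lemma order_cyclic_wreath: "order (cyclic_wreath q p) = nat q ^ nat p * nat p"
  by (simp add: cyclic_wreath_def order_def card_cartesian_product card_PiE)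

lemma cyclic_wreath_base_pow:
  "(f, 0) [^]\<^bsub>cyclic_wreath q p\<^esub> (n::nat) = (\<lambda>i\<in>{0..<p}. (int n * f i) mod q, 0)"
proof (induction n)
  case 0
  then show ?case by (simp add: cyclic_wreath_def restrict_def)
next
  case (Suc n)
  have "(f, 0) [^]\<^bsub>cyclic_wreath q p\<^esub> Suc n = (\<lambda>i\<in>{0..<p}. (int n * f i) mod q, 0) \<otimes>\<^bsub>cyclic_wreath q p\<^esub> (f, 0)"
    unfolding nat_pow_Suc Suc.IH ..
  also have "\<dots> = (\<lambda>i\<in>{0..<p}. (int (Suc n) * f i) mod q, 0)"
    by (auto simp: cyclic_wreath_def mod_simps algebra_simps intro!: restrict_ext)
  finally show ?case .
qed

lemma cyclic_wreath_top_pow: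
  "(\<lambda>i\<in>{0..<p}. 0, s) [^]\<^bsub>cyclic_wreath q p\<^esub> (n::nat) = (\<lambda>i\<in>{0..<p}. 0, (int n * s) mod p)"
proof (induction n)
  case 0
  then show ?case by (simp add: cyclic_wreath_def restrict_def)
next
  case (Suc n)
  have "(\<lambda>i\<in>{0..<p}. 0, s) [^]\<^bsub>cyclic_wreath q p\<^esub> Suc n =
      (\<lambda>i\<in>{0..<p}. 0, (int n * s) mod p) \<otimes>\<^bsub>cyclic_wreath q p\<^esub> (\<lambda>i\<in>{0..<p}. 0, s)"
    unfolding nat_pow_Suc Suc.IH ..
  also have "\<dots> = (\<lambda>i\<in>{0..<p}. 0, (int (Suc n) * s) mod p)"
    using p by (auto simp: cyclic_wreath_def mod_simps algebra_simps intro!: restrict_ext)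
  finally show ?case .
qed

text \<open>By the two power formulas above, the factors have orders dividing \<open>q\<close> and
  \<open>p\<close> respectively.\<close>

lemma cyclic_wreath_decompose:
  assumes "(f, s) \<in> carrier (cyclic_wreath q p)"
  shows "(f, s) = (f, 0) \<otimes>\<^bsub>cyclic_wreath q p\<^esub> (\<lambda>i\<in>{0..<p}. 0, s)"
proof -
  have "f = (\<lambda>i\<in>{0..<p}. f i mod q)"
  proof
    fix i show "f i = (\<lambda>i\<in>{0..<p}. f i mod q) i"
      using assms by (cases "i \<in> {0..<p}") (auto simp: cyclic_wreath_def PiE_def Pi_def extensional_def)
  qed
  then show ?thesis
    using assms p by (auto simp: cyclic_wreath_def cong: restrict_cong)
qed

text \<open>An odometer: rotation by one step, with a carry in the last coordinate. The reductions
  modulo \<open>q\<close> and \<open>p\<close> keep it in the carrier also when one of these is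
  1.\<close>

definition wreath_cycle :: "(int \<Rightarrow> int) \<times> int" where
  "wreath_cycle = (\<lambda>i\<in>{0..<p}. (if i = p - 1 then 1 else 0) mod q, 1 mod p)"

lemma wreath_cycle_carrier: "wreath_cycle \<in> carrier (cyclic_wreath q p)"
  using p q by (auto simp: wreath_cycle_def cyclic_wreath_def)

text \<open>The carry rule: the quotient grows exactly when the remainder wraps around. It drives
  the induction for the powers of \<open>wreath_cycle\<close>.\<close>

lemma div_Suc_eq:
  "(x + 1) div p = x div p + (if x mod p = p - 1 then 1 else 0)"
proof (cases "x mod p = p - 1")
  case True
  then have "x + 1 = p * (x div p + 1)"
    using mult_div_mod_eq[of p x] by (simp only: distrib_left)
  then show ?thesis
    using True p by simp
next
  case False
  then have "x mod p + 1 < p"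
    using pos_mod_bound[OF p, of x] by simp
  then have "(x mod p + 1) div p = 0"
    using p by (intro div_pos_pos_trivial) simp_all
  then show ?thesis
    using False div_add1_eq[of x 1 p] p by (cases "p = 1") (simp_all add: div_pos_pos_trivial mod_pos_pos_trivial)
qed

text \<open>
  Via \<open>(i, a) \<mapsto> i + p a\<close> the cycle acts as the successor on \<open>\<int>/(p q)\<close>: its powers count the carries.
\<close>

lemma wreath_cycle_pow:
  "wreath_cycle [^]\<^bsub>cyclic_wreath q p\<^esub> (n::nat) =
    (\<lambda>i\<in>{0..<p}. ((i + int n) div p) mod q, int n mod p)"
proof (induction n)
  case 0
  then show ?case by (auto simp: cyclic_wreath_def intro!: restrict_ext)
next
  case (Suc n)
  have "wreath_cycle [^]\<^bsub>cyclic_wreath q p\<^esub> Suc n =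
      (\<lambda>i\<in>{0..<p}. ((i + int n) div p) mod q, int n mod p) \<otimes>\<^bsub>cyclic_wreath q p\<^esub> wreath_cycle"
    unfolding nat_pow_Suc Suc.IH ..
  also have "\<dots> = (\<lambda>i\<in>{0..<p}. ((i + int n) div p + (if (i + int n) mod p = p - 1 then 1 else 0)) mod q,
      (int n + 1) mod p)"
    using p by (auto simp: cyclic_wreath_def wreath_cycle_def mod_simps intro!: restrict_ext)
  also have "\<dots> = (\<lambda>i\<in>{0..<p}. ((i + int (Suc n)) div p) mod q, int (Suc n) mod p)"
    using div_Suc_eq[of "_ + int n"] by (auto simp: ac_simps intro!: restrict_ext)
  finally show ?case .
qed

text \<open>By the power formula, the \<open>n\<close>-th power is trivial iff \<open>p\<close>
  divides \<open>n\<close> and the carry count \<open>n div p\<close> vanishes modulo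
  \<open>q\<close>.\<close>

lemma wreath_cycle_ord: "group.ord (cyclic_wreath q p) wreath_cycle = nat q * nat p"
proof -
  interpret group "cyclic_wreath q p"
    by (rule cyclic_wreath_group)
  have "wreath_cycle [^]\<^bsub>cyclic_wreath q p\<^esub> n = \<one>\<^bsub>cyclic_wreath q p\<^esub> \<longleftrightarrow> nat q * nat p dvd n" for n :: nat
  proof
    assume "wreath_cycle [^]\<^bsub>cyclic_wreath q p\<^esub> n = \<one>\<^bsub>cyclic_wreath q p\<^esub>"
    then have eq: "(\<lambda>i\<in>{0..<p}. ((i + int n) div p) mod q) = (\<lambda>i\<in>{0..<p}. 0)" and "int n mod p = 0"
      unfolding wreath_cycle_pow by (auto simp: cyclic_wreath_def)
    then obtain m where m: "int n = p * m"
      by (meson dvdE mod_0_imp_dvd)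
    \<comment> \<open>Coordinate 0 alone already forces \<open>q\<close> to divide
      \<open>n div p\<close>.\<close>
    have "((0 + int n) div p) mod q = 0"
      using fun_cong[OF eq, of 0] p by simp
    then have "q dvd m"
      using m p by (simp add: dvd_eq_mod_eq_0)
    then have "q * p dvd int n"
      using m by (simp add: mult.commute)
    then have "int (nat q * nat p) dvd int n"
      using p q by simp
    then show "nat q * nat p dvd n"
      by (simp only: int_dvd_int_iff)
  next
    assume "nat q * nat p dvd n"
    then obtain m where "n = nat q * nat p * m" ..
    then have n: "int n = p * (q * int m)"
      using p q by simp
    have "(i + int n) div p = q * int m" if "i \<in> {0..<p}" for i
      using that p unfolding n by (simp add: div_pos_pos_trivial)
    then show "wreath_cycle [^]\<^bsub>cyclic_wreath q p\<^esub> n = \<one>\<^bsub>cyclic_wreath q p\<^esub>"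
      unfolding wreath_cycle_pow using n by (auto simp: cyclic_wreath_def intro!: restrict_ext)
  qed
  then show ?thesis
    using ord_unique[OF wreath_cycle_carrier] by simp
qed

end

section \<open>Two facts on solvable groups\<close>

lemma (in group) derived_proper:
  assumes "solvable G" and "order G \<noteq> 1"
  shows "derived G (carrier G) \<noteq> carrier G"
proof
  assume eq: "derived G (carrier G) = carrier G"
  obtain n where "(derived G ^^ n) (carrier G) = {\<one>}"
    using assms(1) solvable_iff_trivial_derived_seq by auto
  moreover have "(derived G ^^ n) (carrier G) = carrier G"
    by (induction n) (simp_all add: eq)
  ultimately show False
    using assms(2) by (simp add: order_def)
qed

lemma (in group) solvable_restrict:
  assumes "solvable G" and H: "subgroup H G"
  shows "solvable (G\<lparr>carrier := H\<rparr>)"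
proof -
  have "group_hom (G\<lparr>carrier := H\<rparr>) G (\<lambda>x. x)"
    by (intro group_homI subgroup_imp_group[OF H] is_group homI)
      (use subgroup.mem_carrier[OF H] in simp_all)
  then show ?thesis
    using group_hom.inj_hom_imp_solvable[of _ G "\<lambda>x. x"] assms(1) by simp
qed

section \<open>Membership of cyclic groups of prime power order\<close>

context Q_fitting_class
begin

lemma in_class_cyclic_dvd:
  assumes "in_class F (integer_mod_group n)" and "m dvd n" and "n > 0"
  shows "in_class F (integer_mod_group m)"
proof -
  obtain k where n: "n = m * k" using assms(2) ..
  let ?Z = "integer_mod_group n"
  interpret comm_group ?Z by simp
  \<comment> \<open>The class of the cofactor \<open>k\<close> generates the subgroup of order
    \<open>m\<close>; the reduction matters for \<open>m = 1\<close>, where \<open>k = n\<close> is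
    not itself a residue.\<close>
  have x: "int k mod int n \<in> carrier ?Z"
    using assms(3) by (simp add: carrier_integer_mod_group)
  have "ord (int k mod int n) = m"
  proof (subst ord_unique[OF x], intro allI)
    fix j :: nat
    have "(int k mod int n) [^]\<^bsub>?Z\<^esub> j = \<one>\<^bsub>?Z\<^esub> \<longleftrightarrow> int n dvd int (j * k)"
      by (simp add: mod_simps dvd_eq_mod_eq_0)
    also have "\<dots> \<longleftrightarrow> m dvd j"
      using assms(3) by (simp only: int_dvd_int_iff n) simp
    finally show "(int k mod int n) [^]\<^bsub>?Z\<^esub> j = \<one>\<^bsub>?Z\<^esub> \<longleftrightarrow> m dvd j" .
  qed
  moreover have "generate ?Z {int k mod int n} \<lhd> ?Z"
    using x by (intro subgroup_imp_normal generate_is_subgroup) simp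
  ultimately show ?thesis
    using in_class_normal[OF assms(1)] in_class_generate_iff[OF is_group x] by simp
qed

text \<open>Every element of the wreath product whose order divides \<open>p ^ n\<close> generates a
  subnormal subgroup in the class, hence lies in the radical. Such elements generate the wreath
  product, so it is in the class, and so is the subnormal cyclic subgroup generated by the odometer,
  of order \<open>p ^ Suc n\<close>.\<close>

lemma in_class_cyclic_prime_power:
  assumes p: "Factorial_Ring.prime p" and Fp: "in_class F (integer_mod_group p)"
  shows "in_class F (integer_mod_group (p ^ n))"
proof (induction n)
  case 0
  have "integer_mod_group 1\<lparr>carrier := {\<one>\<^bsub>integer_mod_group 1\<^esub>}\<rparr> = integer_mod_group 1"
    by (auto simp: integer_mod_group_def)
  then show ?case
    using in_class_trivial[OF group_integer_mod_group, of 1] by simp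
next
  case (Suc n)
  show ?case
  \<comment> \<open>The wreath product argument needs the order of a top element, a divisor of
    \<open>p\<close>, to divide \<open>p ^ n\<close>. For \<open>n = 0\<close> the claim is the
    hypothesis.\<close>
  proof (cases "n = 0")
    case True
    then show ?thesis using Fp by simp
  next
    case False
    define W where "W = cyclic_wreath (int (p ^ n)) (int p)"
    have pos: "int (p ^ n) > 0" "int p > 0"
      using prime_gt_0_nat[OF p] by simp_all
    interpret W: group W
      unfolding W_def using pos by (rule cyclic_wreath_group)
    have ordW: "order W = p ^ (n * p + 1)"
      unfolding W_def using order_cyclic_wreath[OF pos] by (simp add: nat_power_eq power_mult)
    have finW: "finite (carrier W)"
      using ordW p W.order_gt_0_iff_finite by (simp add: prime_gt_0_nat)
    let ?R = "class_radical F W"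
    interpret R: normal ?R W
      using class_radical_normal[OF W.is_group finW] .
    have rad: "x \<in> ?R" if x: "x \<in> carrier W" and "x [^]\<^bsub>W\<^esub> (p ^ n) = \<one>\<^bsub>W\<^esub>" for x
    proof -
      have "W.ord x dvd p ^ n"
        using that W.pow_eq_id by simp
      then have "in_class F (W\<lparr>carrier := generate W {x}\<rparr>)"
        using in_class_cyclic_dvd[OF Suc.IH] p in_class_generate_iff[OF W.is_group x]
        by (simp add: prime_gt_0_nat)
      moreover have "subnormal W (generate W {x})"
        using x by (intro W.p_group_subgroup_subnormal[OF p ordW] W.generate_is_subgroup) simp
      ultimately show ?thesis
        using subnormal_subset_class_radical[OF W.is_group finW] generate.incl[of x "{x}" W] by blast
    qed
    have "x \<in> ?R" if x: "x \<in> carrier W" for x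
    proof -
      obtain f s where fs: "x = (f, s)" by (cases x)
      let ?t = "(\<lambda>i\<in>{0..<int p}. 0, s) :: (int \<Rightarrow> int) \<times> int"
      have "(f, 0) \<in> carrier W" and t: "?t \<in> carrier W"
        using x fs pos by (auto simp: W_def cyclic_wreath_def)
      moreover have "(f, 0) [^]\<^bsub>W\<^esub> (p ^ n) = \<one>\<^bsub>W\<^esub>"
        unfolding W_def cyclic_wreath_base_pow[OF pos] by (auto simp: cyclic_wreath_def intro!: restrict_ext)
      moreover have "?t [^]\<^bsub>W\<^esub> (p ^ n) = \<one>\<^bsub>W\<^esub>"
        unfolding W_def cyclic_wreath_top_pow[OF pos] using False
        by (auto simp: cyclic_wreath_def dvd_power)
      ultimately have "(f, 0) \<otimes>\<^bsub>W\<^esub> ?t \<in> ?R"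
        by (intro R.m_closed rad)
      then show ?thesis
        using cyclic_wreath_decompose[OF pos, of f s] x fs by (simp add: W_def)
    qed
    then have "?R = carrier W"
      using R.subset by blast
    then have FW: "in_class F W"
      using in_class_radical[OF W.is_group finW] by simp
    let ?g = "wreath_cycle (int (p ^ n)) (int p)"
    have g: "?g \<in> carrier W"
      unfolding W_def using pos by (rule wreath_cycle_carrier)
    have "subnormal W (generate W {?g})"
      using g by (intro W.p_group_subgroup_subnormal[OF p ordW] W.generate_is_subgroup) simp
    then have "in_class F (integer_mod_group (W.ord ?g))"
      using in_class_subnormal[OF FW] in_class_generate_iff[OF W.is_group g] by simp
    moreover have "W.ord ?g = p ^ Suc n"
      unfolding W_def using wreath_cycle_ord[OF pos] by (simp add: nat_power_eq mult.commute)
    ultimately show ?thesis by simp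
  qed
qed

text \<open>If \<open>p\<close> divides the order of the derived subgroup, descend to it: it is
  normal, in the class and smaller by solvability. Otherwise \<open>p\<close> divides the order of
  the abelian quotient, which is in the class; there an element of order \<open>p\<close> generates
  a normal subgroup.\<close>

lemma solvable_in_class_cyclic_prime:
  assumes "in_class F G" and "solvable G" and p: "Factorial_Ring.prime p" and "p dvd order G"
  shows "in_class F (integer_mod_group p)"
  using assms(1,2,4)
proof (induction "card (carrier G)" arbitrary: G rule: less_induct)
  case less
  interpret group G
    using less.prems(1) by (rule in_class_group)
  let ?D = "derived G (carrier G)"
  have fin: "finite (carrier G)"
    using less.prems(1) by (rule in_class_finite)
  have D: "?D \<lhd> G"
    by (rule derived_self_is_normal)
  show ?case
  proof (cases "p dvd card ?D")
    case True
    have "order G \<noteq> 1"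
      using less.prems(3) prime_gt_1_nat[OF p] by auto
    then have "?D \<subset> carrier G"
      using derived_proper[OF less.prems(2)] subgroup.subset[OF normal_imp_subgroup[OF D]] by blast
    then have "card ?D < card (carrier G)"
      using psubset_card_mono[OF fin] by simp
    then show ?thesis
      using less.hyps[OF _ in_class_normal[OF less.prems(1) D]
          solvable_restrict[OF less.prems(2) normal_imp_subgroup[OF D]]] True
      by (simp add: order_def)
  next
    case False
    let ?A = "G Mod ?D"
    interpret D: normal ?D G by (rule D)
    interpret A: comm_group ?A
      by (rule derived_quot_is_comm_group)
    have finA: "finite (carrier ?A)"
      using D.finite_Mod[OF fin] .
    have "(#>\<^bsub>G\<^esub>) ?D \<in> epi G ?A"
      using D.r_coset_hom_Mod by (simp add: epi_def carrier_FactGroup)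
    then have FA: "in_class F ?A"
      using in_class_epi[OF less.prems(1) A.is_group] by simp
    have "card (rcosets\<^bsub>G\<^esub> ?D) * card ?D = order G"
      using lagrange[OF D.subgroup_axioms] .
    then have "p dvd card (rcosets\<^bsub>G\<^esub> ?D)"
      using less.prems(3) False p prime_dvd_mult_iff by metis
    then have "p dvd order ?A"
      by (simp add: order_def FactGroup_def)
    \<comment> \<open>Exponent 1 turns the Sylow theorem into Cauchy's theorem:
      \<open>sylow_thm\<close> does not ask for \<open>m\<close> to be prime to
      \<open>p\<close>.\<close>
    then obtain m where "order ?A = p ^ 1 * m"
      by (auto elim: dvdE)
    then obtain P where P: "subgroup P ?A" "card P = p ^ 1"
      using sylow_thm[OF p A.is_group _ finA] by blast
    obtain x where x: "x \<in> P" "x \<noteq> \<one>\<^bsub>?A\<^esub>"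
    proof (rule ccontr)
      assume "\<not> thesis"
      then have "P \<subseteq> {\<one>\<^bsub>?A\<^esub>}"
        using that by blast
      then have "card P \<le> 1"
        using card_mono[of "{\<one>\<^bsub>?A\<^esub>}" P] by simp
      then show False
        using P(2) prime_gt_1_nat[OF p] by simp
    qed
    interpret P: group "?A\<lparr>carrier := P\<rparr>"
      using A.subgroup_imp_group[OF P(1)] .
    have xA: "x \<in> carrier ?A"
      using subgroup.mem_carrier[OF P(1) x(1)] .
    have "x [^]\<^bsub>?A\<lparr>carrier := P\<rparr>\<^esub> order (?A\<lparr>carrier := P\<rparr>) = \<one>\<^bsub>?A\<^esub>"
      using P.pow_order_eq_1[of x] x(1) by simp
    then have "x [^]\<^bsub>?A\<^esub> p = \<one>\<^bsub>?A\<^esub>"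
      using P(2) by (simp add: order_def nat_pow_def)
    then have "A.ord x dvd p"
      using A.pow_eq_id[OF xA] by simp
    then have "A.ord x = p"
      using A.ord_eq_1[OF xA] x(2) p by (metis prime_nat_iff)
    moreover have "generate ?A {x} \<lhd> ?A"
      using xA by (intro A.subgroup_imp_normal A.generate_is_subgroup) simp
    ultimately show ?thesis
      using in_class_normal[OF FA] in_class_generate_iff[OF A.is_group xA] by simp
  qed
qed

end

section \<open>The radical contains its centraliser\<close>

lemma eq_prime_power:
  fixes n :: nat
  assumes p: "Factorial_Ring.prime p" and "n > 0"
    and only: "\<And>q. Factorial_Ring.prime q \<Longrightarrow> q dvd n \<Longrightarrow> q = p"
  obtains k where "n = p ^ k"
proof -
  have "\<not> is_unit p" "n \<noteq> 0"
    using p assms(2) by auto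
  then obtain m where m: "n = p ^ multiplicity p n * m" "\<not> p dvd m"
    using multiplicity_decompose'[of n p] by blast
  have "m = 1"
  proof (rule ccontr)
    assume "m \<noteq> 1"
    then obtain q where q: "Factorial_Ring.prime q" "q dvd m"
      using prime_factor_nat by blast
    then have "q = p"
      using only m(1) by (metis dvd_mult)
    with q m(2) show False by simp
  qed
  with m that show thesis by simp
qed

text \<open>
  An element of minimal order outside a subgroup: if two distinct primes divided its order, its powers
  with these exponents, and hence by Bezout the element itself, would lie in the subgroup.
\<close>

lemma (in group) prime_power_order_outside:
  assumes fin: "finite (carrier G)" and H: "subgroup H G" and K: "subgroup K G" and "\<not> K \<subseteq> H"
  obtains x p k where "x \<in> K" "x \<notin> H" "Factorial_Ring.prime p" "p dvd ord x" "ord x = p ^ k"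
proof -
  interpret H: subgroup H G by fact
  interpret K: subgroup K G by fact
  obtain z where "z \<in> K \<and> z \<notin> H"
    using assms(4) by blast
  then obtain x where x: "x \<in> K" "x \<notin> H"
    and min: "\<And>y. y \<in> K \<Longrightarrow> y \<notin> H \<Longrightarrow> ord x \<le> ord y"
    using ex_has_least_nat[of "\<lambda>x. x \<in> K \<and> x \<notin> H" z ord] by auto
  have xG: "x \<in> carrier G"
    using x(1) by (rule K.mem_carrier)
  have pos: "ord x > 0"
    using ord_ge_1[OF fin xG] by simp
  have power: "x [^] q \<in> H" if q: "Factorial_Ring.prime q" "q dvd ord x" for q :: nat
  proof (rule ccontr)
    assume "x [^] q \<notin> H"
    moreover have "x [^] q \<in> K"
      using x(1) K.subgroup_axioms by (induction q) simp_all
    ultimately have "ord x \<le> ord (x [^] q)"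
      by (intro min)
    also have "\<dots> = ord x div q"
      using ord_pow[OF xG q(2)] q(1) prime_gt_0_nat by blast
    also have "\<dots> < ord x"
      using pos prime_gt_1_nat[OF q(1)] by simp
    finally show False by simp
  qed
  have "ord x \<noteq> 1"
    using ord_eq_1[OF xG] x(2) by auto
  then obtain p where p: "Factorial_Ring.prime p" "p dvd ord x"
    using prime_factor_nat by blast
  have "q = p" if q: "Factorial_Ring.prime q" "q dvd ord x" for q
  proof (rule ccontr)
    assume "q \<noteq> p"
    then have "gcd (int q) (int p) = 1"
      using primes_coprime[OF q(1) p(1)] by (simp add: coprime_iff_gcd_eq_1)
    then obtain u v where uv: "u * int q + v * int p = 1"
      using bezout_int[of "int q" "int p"] by auto
    have "x = x [^] (int q * u + int p * v)"
      using uv xG by (simp add: mult.commute)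
    also have "\<dots> = (x [^] q) [^] u \<otimes> (x [^] p) [^] v"
      using xG by (simp add: int_pow_mult int_pow_pow flip: int_pow_int)
    finally have "x = (x [^] q) [^] u \<otimes> (x [^] p) [^] v" .
    moreover have "(x [^] q) [^] u \<otimes> (x [^] p) [^] v \<in> H"
      using subgroup_int_pow_closed[OF H power[OF q]] subgroup_int_pow_closed[OF H power[OF p]] by simp
    ultimately show False
      using x(2) by simp
  qed
  then obtain k where "ord x = p ^ k"
    using eq_prime_power[OF p(1) pos] by blast
  with x p show thesis
    by (intro that)
qed

section \<open>Derived series, centralisers and subnormal cyclic subgroups\<close>

lemma (in group) derived_funpow_normal:
  assumes "N \<lhd> G"
  shows "(derived G ^^ n) N \<lhd> G \<and> (derived G ^^ n) N \<subseteq> N"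
proof (induction n)
  case (Suc n)
  then show ?case
    using derived_is_normal derived_incl[of _ N] normal_imp_subgroup[OF assms] by simp
qed (simp add: assms)

text \<open>\<open>D\<close> is the last term of the derived series of \<open>N\<close> that is not
  inside \<open>R\<close>; it exists because the series ends at the identity, which lies in
  \<open>R\<close>.\<close>

lemma (in group) last_derived_not_subset:
  assumes "solvable G" and N: "N \<lhd> G" and R: "subgroup R G" and "\<not> N \<subseteq> R"
  obtains D where "D \<lhd> G" "D \<subseteq> N" "\<not> D \<subseteq> R" "derived G D \<subseteq> R"
proof -
  let ?D = "\<lambda>n. (derived G ^^ n) N"
  obtain n where "?D n = {\<one>}"
    using solvable_imp_trivial_derived_seq[OF solvable_subgroup[OF normal_imp_subgroup[OF N] assms(1)]]
    by blast
  then have "?D n \<subseteq> R"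
    using subgroup.one_closed[OF R] by simp
  moreover have "\<not> ?D 0 \<subseteq> R"
    using assms(4) by simp
  ultimately have "\<exists>m<n. (\<forall>i\<le>m. \<not> ?D i \<subseteq> R) \<and> ?D (Suc m) \<subseteq> R"
    by (rule ex_least_nat_less)
  then obtain m where "\<forall>i\<le>m. \<not> ?D i \<subseteq> R" "?D (Suc m) \<subseteq> R"
    by auto
  then show thesis
    using that[of "?D m"] derived_funpow_normal[OF N, of m] by simp
qed

lemma (in group) normal_centralizer:
  assumes N: "N \<lhd> G"
  shows "{a \<in> carrier G. \<forall>r\<in>N. a \<otimes> r = r \<otimes> a} \<lhd> G" (is "?C \<lhd> G")
proof -
  interpret N: normal N G by fact
  have comm: "a \<otimes> r = r \<otimes> a" if "a \<in> ?C" "r \<in> N" for a r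
    using that by simp
  have "subgroup ?C G"
  proof (rule subgroupI)
    show "?C \<subseteq> carrier G" by auto
    have "\<one> \<in> ?C" by simp
    then show "?C \<noteq> {}" by blast
    show "inv a \<in> ?C" if a: "a \<in> ?C" for a
    proof -
      have aG: "a \<in> carrier G" using a by simp
      have "inv a \<otimes> r = r \<otimes> inv a" if r: "r \<in> N" for r
      proof -
        have rG: "r \<in> carrier G" using r by (rule N.mem_carrier)
        have "inv a \<otimes> r = inv a \<otimes> (r \<otimes> a) \<otimes> inv a"
          using aG rG by (simp add: m_assoc)
        also have "\<dots> = inv a \<otimes> (a \<otimes> r) \<otimes> inv a"
          using comm[OF a r] by simp
        also have "\<dots> = r \<otimes> inv a"
          using aG rG by (simp flip: m_assoc)
        finally show ?thesis .
      qed
      with aG show ?thesis by simp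
    qed
    show "a \<otimes> b \<in> ?C" if ab: "a \<in> ?C" "b \<in> ?C" for a b
    proof -
      have G: "a \<in> carrier G" "b \<in> carrier G" using ab by auto
      have "a \<otimes> b \<otimes> r = r \<otimes> (a \<otimes> b)" if r: "r \<in> N" for r
      proof -
        have rG: "r \<in> carrier G" using r by (rule N.mem_carrier)
        have "a \<otimes> b \<otimes> r = a \<otimes> (r \<otimes> b)"
          using G rG comm[OF ab(2) r] by (simp add: m_assoc)
        also have "\<dots> = a \<otimes> r \<otimes> b"
          using G rG by (simp add: m_assoc)
        also have "\<dots> = r \<otimes> a \<otimes> b"
          using comm[OF ab(1) r] by simp
        finally show ?thesis
          using G rG by (simp add: m_assoc)
      qed
      with G show ?thesis by simp
    qed
  qed
  moreover have "x \<otimes> a \<otimes> inv x \<in> ?C" if x: "x \<in> carrier G" and a: "a \<in> ?C" for x a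
  proof -
    have aG: "a \<in> carrier G" using a by simp
    have "x \<otimes> a \<otimes> inv x \<otimes> r = r \<otimes> (x \<otimes> a \<otimes> inv x)" if r: "r \<in> N" for r
    proof -
      have rG: "r \<in> carrier G" using r by (rule N.mem_carrier)
      let ?r = "inv x \<otimes> r \<otimes> x"
      have "?r \<in> N"
        using N.inv_op_closed1[OF x r] .
      then have "a \<otimes> ?r = ?r \<otimes> a"
        using comm[OF a] by simp
      then have "x \<otimes> (a \<otimes> ?r) \<otimes> inv x = x \<otimes> (?r \<otimes> a) \<otimes> inv x"
        by simp
      moreover have "x \<otimes> (a \<otimes> ?r) \<otimes> inv x = x \<otimes> a \<otimes> inv x \<otimes> r"
        using x aG rG by (simp add: m_assoc)
      moreover have "x \<otimes> (?r \<otimes> a) \<otimes> inv x = r \<otimes> (x \<otimes> a \<otimes> inv x)"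
        using x aG rG by (simp add: m_assoc flip: m_assoc[of x "inv x"])
      ultimately show ?thesis by simp
    qed
    with x aG show ?thesis by simp
  qed
  ultimately show ?thesis
    by (simp only: normal_inv_iff) blast
qed

text \<open>
  The cyclic subgroup is normal in its product with the subgroup \<open>D \<inter> R\<close>, which it centralises, and
  that product contains the commutator subgroup of \<open>D\<close>.
\<close>

lemma (in group) cyclic_subnormal_centralizing:
  assumes D: "D \<lhd> G" and R: "R \<lhd> G" and der: "derived G D \<subseteq> R"
    and comm: "\<And>d r. d \<in> D \<Longrightarrow> r \<in> R \<Longrightarrow> d \<otimes> r = r \<otimes> d" and x: "x \<in> D"
  shows "subnormal G (generate G {x})"
proof -
  interpret D: normal D G by fact
  interpret R: normal R G by fact
  let ?X = "generate G {x}" and ?Z = "D \<inter> R"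
  let ?A = "?Z <#> ?X"
  have X: "subgroup ?X G"
    using x by (intro generate_is_subgroup) simp
  interpret X: subgroup ?X G by (rule X)
  have XD: "?X \<subseteq> D"
    using generate_subgroup_incl[OF _ D.subgroup_axioms] x by simp
  have Z: "?Z \<lhd> G"
    using D R by (rule normal_subgroup_intersect)
  interpret Z: normal ?Z G by (rule Z)
  have A: "subgroup ?A G"
    using Z X by (rule mult_norm_subgroup)
  interpret A: subgroup ?A G by (rule A)
  have sub: "?Z \<subseteq> ?A" "?X \<subseteq> ?A"
    using subset_set_mult[OF Z.subgroup_axioms X] .
  have AD: "?A \<subseteq> D"
    using XD by (auto simp: set_mult_def)
  have "?A \<lhd> G\<lparr>carrier := D\<rparr>"
    unfolding group.normal_inv_iff[OF normal_subgroup_group[OF D]]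
  proof (intro conjI ballI)
    show "subgroup ?A (G\<lparr>carrier := D\<rparr>)"
      using subgroup_incl[OF A D.subgroup_axioms AD] .
    fix d a assume d: "d \<in> carrier (G\<lparr>carrier := D\<rparr>)" and a: "a \<in> ?A"
    have dG: "d \<in> carrier G" and aG: "a \<in> carrier G" and aD: "a \<in> D"
      using d a AD by auto
    have "d \<otimes> a \<otimes> inv d \<otimes> inv a \<in> derived_set G D"
      using d aD by auto
    then have "d \<otimes> a \<otimes> inv d \<otimes> inv a \<in> derived G D"
      unfolding derived_def by (rule generate.incl)
    moreover have "derived G D \<subseteq> D"
      using derived_incl[OF subset_refl D.subgroup_axioms] .
    ultimately have "d \<otimes> a \<otimes> inv d \<otimes> inv a \<in> ?A"
      using der sub(1) by blast
    then have "d \<otimes> a \<otimes> inv d \<otimes> inv a \<otimes> a \<in> ?A"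
      using a by (rule A.m_closed)
    then have "d \<otimes> a \<otimes> inv d \<in> ?A"
      using dG aG by (simp add: m_assoc)
    then show "d \<otimes>\<^bsub>G\<lparr>carrier := D\<rparr>\<^esub> a \<otimes>\<^bsub>G\<lparr>carrier := D\<rparr>\<^esub> inv\<^bsub>G\<lparr>carrier := D\<rparr>\<^esub> d \<in> ?A"
      using m_inv_consistent[OF D.subgroup_axioms] d by simp
  qed
  then have "subnormal G ?A"
    using normal_imp_subnormal[OF D] by (rule subnormal.normal[rotated])
  moreover have "?X \<lhd> G\<lparr>carrier := ?A\<rparr>"
    unfolding group.normal_inv_iff[OF subgroup_imp_group[OF A]]
  proof (intro conjI ballI)
    show "subgroup ?X (G\<lparr>carrier := ?A\<rparr>)"
      using subgroup_incl[OF X A sub(2)] .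
    fix a c assume a: "a \<in> carrier (G\<lparr>carrier := ?A\<rparr>)" and c: "c \<in> ?X"
    obtain z y where zy: "z \<in> ?Z" "y \<in> ?X" "a = z \<otimes> y"
      using a by (auto simp: set_mult_def)
    have G: "z \<in> carrier G" "y \<in> carrier G" "c \<in> carrier G"
      using zy c X.mem_carrier by auto
    let ?c = "y \<otimes> c \<otimes> inv y"
    have cX: "?c \<in> ?X"
      using zy c by simp
    have "a \<otimes> c \<otimes> inv a = z \<otimes> ?c \<otimes> inv z"
      using G by (simp add: zy(3) m_assoc inv_mult_group)
    also have "\<dots> = ?c \<otimes> z \<otimes> inv z"
      using comm[of ?c z] cX XD zy(1) by auto
    also have "\<dots> = ?c"
      using G by (simp add: m_assoc)
    finally have "a \<otimes> c \<otimes> inv a \<in> ?X"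
      using cX by simp
    then show "a \<otimes>\<^bsub>G\<lparr>carrier := ?A\<rparr>\<^esub> c \<otimes>\<^bsub>G\<lparr>carrier := ?A\<rparr>\<^esub> inv\<^bsub>G\<lparr>carrier := ?A\<rparr>\<^esub> a \<in> ?X"
      using m_inv_consistent[OF A] a by simp
  qed
  ultimately show ?thesis
    by (rule subnormal.normal)
qed

locale soluble_Q_fitting_class = Q_fitting_class +
  assumes soluble: "\<And>H. H \<in> F \<Longrightarrow> solvable H"
begin

lemma in_class_cyclic_class_primes:
  assumes "p \<in> class_primes F"
  shows "in_class F (integer_mod_group (p ^ n))"
proof -
  obtain H where H: "H \<in> F" "p dvd order H" and p: "Factorial_Ring.prime p"
    using assms by (auto simp: class_primes_def)
  show ?thesis
    using in_class_cyclic_prime_power[OF p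
        solvable_in_class_cyclic_prime[OF in_class_F[OF H(1)] soluble[OF H(1)] p H(2)]] .
qed

text \<open>If the centraliser \<open>C\<close> of the radical were not inside it, some normal
  \<open>D\<close> in \<open>C\<close> would escape the radical while its derived subgroup does not.
  An element of \<open>D\<close> outside the radical of prime power order generates a cyclic
  subgroup that is in the class, as its prime lies in \<open>class_primes F\<close>, and is
  subnormal. So the radical contains it, a contradiction.\<close>

lemma class_radical_self_centralizing:
  assumes pi: "pi_group (class_primes F) G" and sol: "solvable G" and a: "a \<in> carrier G"
    and comm: "\<And>r. r \<in> class_radical F G \<Longrightarrow> a \<otimes>\<^bsub>G\<^esub> r = r \<otimes>\<^bsub>G\<^esub> a"
  shows "a \<in> class_radical F G"
proof (rule ccontr)
  assume nota: "a \<notin> class_radical F G"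
  interpret group G
    using pi by (simp add: pi_group_def)
  have fin: "finite (carrier G)"
    using pi by (simp add: pi_group_def)
  let ?R = "class_radical F G"
  define C where "C = {a \<in> carrier G. \<forall>r\<in>?R. a \<otimes>\<^bsub>G\<^esub> r = r \<otimes>\<^bsub>G\<^esub> a}"
  have R: "?R \<lhd> G"
    using class_radical_normal[OF is_group fin] .
  have C: "C \<lhd> G"
    unfolding C_def using R by (rule normal_centralizer)
  have "a \<in> C"
    using a comm by (simp add: C_def)
  with nota have "\<not> C \<subseteq> ?R" by blast
  then obtain D where D: "D \<lhd> G" "D \<subseteq> C" "\<not> D \<subseteq> ?R" "derived G D \<subseteq> ?R"
    using last_derived_not_subset[OF sol C normal_imp_subgroup[OF R]] by metis
  obtain x p k where x: "x \<in> D" "x \<notin> ?R" and p: "Factorial_Ring.prime p" "p dvd ord x"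
    and k: "ord x = p ^ k"
    using prime_power_order_outside[OF fin normal_imp_subgroup[OF R] normal_imp_subgroup[OF D(1)] D(3)]
    by metis
  have xG: "x \<in> carrier G"
    using subgroup.mem_carrier[OF normal_imp_subgroup[OF D(1)] x(1)] .
  have "p dvd order G"
    using p(2) ord_dvd_group_order[OF xG] by (rule dvd_trans)
  then have "p \<in> class_primes F"
    using pi p(1) by (simp add: pi_group_def)
  then have "in_class F (G\<lparr>carrier := generate G {x}\<rparr>)"
    using in_class_cyclic_class_primes in_class_generate_iff[OF is_group xG] k by simp
  moreover have "subnormal G (generate G {x})"
    using D(2) x(1) by (intro cyclic_subnormal_centralizing[OF D(1) R D(4)]) (auto simp: C_def)
  ultimately have "generate G {x} \<subseteq> ?R"
    using subnormal_subset_class_radical[OF is_group fin] by simp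
  then show False
    using x(2) generate.incl[of x "{x}" G] by blast
qed

end

section \<open>The series of a maximal subgroup\<close>

lemma pi_group_Mod:
  assumes pi: "pi_group P G" and N: "N \<lhd> G"
  shows "pi_group P (G Mod N)"
proof -
  interpret N: normal N G by fact
  have "order (G Mod N) dvd order G"
    using N.lagrange[OF N.subgroup_axioms] by (metis FactGroup_def dvd_triv_left order_def partial_object.select_convs(1))
  moreover have "finite (carrier (G Mod N))"
    using N.finite_Mod pi by (simp add: pi_group_def)
  ultimately show ?thesis
    using pi N.factorgroup_is_group dvd_trans unfolding pi_group_def by metis
qed

lemma solvable_Mod:
  assumes "solvable G" and N: "N \<lhd> G"
  shows "solvable (G Mod N)"
  using group_hom.surj_hom_imp_solvable[OF normal.group_hom_r_coset[OF N] _ assms(1)]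
  by (simp add: carrier_FactGroup)

section \<open>Growth of the series, and comparison with a subgroup\<close>

context soluble_Q_fitting_class
begin

text \<open>If the series stalls, the quotient has trivial radical. Every element centralises the
  trivial group, so the quotient is trivial by
  \<open>class_radical_self_centralizing\<close>.\<close>

lemma radical_series_Suc_neq:
  assumes pi: "pi_group (class_primes F) G" and sol: "solvable G"
    and "radical_series G i \<noteq> carrier G"
  shows "radical_series G (Suc i) \<noteq> radical_series G i"
proof
  assume eq: "radical_series G (Suc i) = radical_series G i"
  have fin: "finite (carrier G)" and gG: "group G"
    using pi by (simp_all add: pi_group_def)
  let ?R = "radical_series G i"
  have R: "?R \<lhd> G"
    using radical_series_normal[OF gG fin] .
  interpret R: normal ?R G by (rule R)
  let ?Q = "G Mod ?R"
  interpret Q: group ?Q by (rule R.factorgroup_is_group)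
  have rad: "U = \<one>\<^bsub>?Q\<^esub>" if U: "U \<in> class_radical F ?Q" for U
  proof -
    have "U \<in> carrier ?Q"
      using subgroup.mem_carrier[OF normal_imp_subgroup[OF
          class_radical_normal[OF Q.is_group R.finite_Mod[OF fin]]] U] .
    then obtain x where x: "x \<in> carrier G" "U = ?R #>\<^bsub>G\<^esub> x"
      by (auto simp: carrier_FactGroup)
    then have "x \<in> radical_series G (Suc i)"
      using U by simp
    then have "x \<in> ?R"
      by (simp only: eq)
    then show ?thesis
      using x R.r_coset_eq_self_iff by simp
  qed
  have "x \<in> ?R" if x: "x \<in> carrier G" for x
  proof -
    have mem: "?R #>\<^bsub>G\<^esub> x \<in> carrier ?Q"
      using x by (auto simp: carrier_FactGroup)
    have "?R #>\<^bsub>G\<^esub> x \<in> class_radical F ?Q"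
    proof (rule class_radical_self_centralizing[OF pi_group_Mod[OF pi R] solvable_Mod[OF sol R] mem])
      fix r assume "r \<in> class_radical F ?Q"
      then have "r = \<one>\<^bsub>?Q\<^esub>" by (rule rad)
      then show "(?R #>\<^bsub>G\<^esub> x) \<otimes>\<^bsub>?Q\<^esub> r = r \<otimes>\<^bsub>?Q\<^esub> (?R #>\<^bsub>G\<^esub> x)"
        using Q.l_one[OF mem] Q.r_one[OF mem] by (simp only:)
    qed
    then have "?R #>\<^bsub>G\<^esub> x = \<one>\<^bsub>?Q\<^esub>" by (rule rad)
    then show ?thesis
      using R.r_coset_eq_self_iff[OF x] by simp
  qed
  then show False
    using assms(3) R.subset by blast
qed

text \<open>Before it reaches \<open>G\<close> the series grows strictly, so otherwise its
  \<open>i\<close>-th term would have at least \<open>i\<close> elements for every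
  \<open>i\<close>.\<close>

lemma radical_series_reaches:
  assumes pi: "pi_group (class_primes F) G" and sol: "solvable G"
  obtains h where "radical_series G h = carrier G"
proof (rule ccontr)
  assume "\<not> thesis"
  then have neq: "radical_series G i \<noteq> carrier G" for i
    using that by blast
  have fin: "finite (carrier G)" and gG: "group G"
    using pi by (simp_all add: pi_group_def)
  have finS: "finite (radical_series G i)" for i
    using normal_finite[OF radical_series_normal[OF gG fin] fin] .
  have "i \<le> card (radical_series G i)" for i
  proof (induction i)
    case (Suc i)
    have "radical_series G i \<subset> radical_series G (Suc i)"
      using radical_series_Suc_mono[OF gG fin, of i] radical_series_Suc_neq[OF pi sol neq, of i]
      by (rule psubsetI[OF _ not_sym])
    then have "card (radical_series G i) < card (radical_series G (Suc i))"
      by (rule psubset_card_mono[OF finS])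
    with Suc.IH show ?case by linarith
  qed simp
  then have "Suc (card (carrier G)) \<le> card (radical_series G (Suc (card (carrier G))))" .
  also have "\<dots> \<le> card (carrier G)"
    using card_mono[OF fin subgroup.subset[OF normal_imp_subgroup[OF radical_series_normal[OF gG fin]]]] .
  finally show False by simp
qed

text \<open>\<open>V\<close> and \<open>T\<close> are normal in \<open>M\<close>, so their
  commutators lie in the intersection, which is contained in \<open>R\<close>. Thus \<open>V\<close>
  centralises, modulo \<open>R\<close>, the group \<open>T\<close> whose quotient is the radical of
  \<open>G Mod R\<close>, and must lie in \<open>T\<close>.\<close>

lemma radical_series_subgroup_above:
  assumes pi: "pi_group (class_primes F) G" and sol: "solvable G" and M: "subgroup M G"
    and TM: "radical_series G (Suc i) \<subseteq> M"
  shows "radical_series (G\<lparr>carrier := M\<rparr>) i \<subseteq> radical_series G (Suc i)"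
proof
  interpret group G
    using pi by (simp add: pi_group_def)
  interpret M: subgroup M G by (rule M)
  let ?M = "G\<lparr>carrier := M\<rparr>"
  have fin: "finite (carrier G)"
    using pi by (simp add: pi_group_def)
  have gM: "group ?M"
    using M by (rule subgroup_imp_group)
  have finM: "finite (carrier ?M)"
    using finite_subset[OF M.subset fin] by simp
  define R T V where "R = radical_series G i" and "T = radical_series G (Suc i)"
    and "V = radical_series ?M i"
  have T_alt: "T = {x \<in> carrier G. R #>\<^bsub>G\<^esub> x \<in> class_radical F (G Mod R)}"
    by (simp add: T_def R_def)
  have R: "R \<lhd> G" and T: "T \<lhd> G" and V: "V \<lhd> ?M"
    unfolding R_def T_def V_def
    by (rule radical_series_normal[OF is_group fin] radical_series_normal[OF gM finM])+
  interpret R: normal R G by (rule R)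
  interpret T: normal T G by (rule T)
  interpret V: normal V ?M by (rule V)
  have TM: "T \<subseteq> M"
    using TM unfolding T_def .
  have "T \<lhd> ?M"
    using normal_restrict_supergroup[OF M T TM] .
  \<comment> \<open>Both sides are the \<open>i\<close>-th term of the series of \<open>T\<close>,
    viewed as a normal subgroup of \<open>M\<close> and of \<open>G\<close>.\<close>
  then have "T \<inter> V = T \<inter> R"
    using radical_series_of_normal[of T ?M, OF _ finM, of i] radical_series_of_normal[OF T fin, of i]
    by (simp add: V_def R_def)
  then have TV: "T \<inter> V \<subseteq> R" by simp
  fix x assume "x \<in> radical_series ?M i"
  then have xV: "x \<in> V" by (simp add: V_def)
  then have xM: "x \<in> M"
    using V.mem_carrier by simp
  have x: "x \<in> carrier G"
    using xM by simp
  have mem: "R #>\<^bsub>G\<^esub> x \<in> carrier (G Mod R)"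
    using x by (auto simp: carrier_FactGroup)
  have "R #>\<^bsub>G\<^esub> x \<in> class_radical F (G Mod R)"
  proof (rule class_radical_self_centralizing[OF pi_group_Mod[OF pi R] solvable_Mod[OF sol R] mem])
    fix U assume U: "U \<in> class_radical F (G Mod R)"
    have "U \<in> carrier (G Mod R)"
      using subgroup.mem_carrier[OF normal_imp_subgroup[OF
          class_radical_normal[OF R.factorgroup_is_group R.finite_Mod[OF fin]]] U] .
    then obtain t where t: "t \<in> carrier G" and Ut: "U = R #>\<^bsub>G\<^esub> t"
      by (auto simp: carrier_FactGroup)
    have tT: "t \<in> T"
      unfolding T_alt using t U Ut by simp
    \<comment> \<open>Bracketed as a conjugate of \<open>t\<close> times \<open>inv t\<close>, the
      commutator is in \<open>T\<close>; as \<open>x\<close> times a conjugate of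
      \<open>inv x\<close>, it is in \<open>V\<close>.\<close>
    let ?c = "x \<otimes>\<^bsub>G\<^esub> t \<otimes>\<^bsub>G\<^esub> inv\<^bsub>G\<^esub> x \<otimes>\<^bsub>G\<^esub> inv\<^bsub>G\<^esub> t"
    have "?c \<in> T"
      using T.inv_op_closed2[OF x tT] tT by simp
    moreover have "?c \<in> V"
    proof -
      have "inv\<^bsub>G\<^esub> x \<in> V"
        using V.m_inv_closed[OF xV] m_inv_consistent[OF M xM] by simp
      then have "t \<otimes>\<^bsub>G\<^esub> inv\<^bsub>G\<^esub> x \<otimes>\<^bsub>G\<^esub> inv\<^bsub>G\<^esub> t \<in> V"
        using V.inv_op_closed2[of t "inv\<^bsub>G\<^esub> x"] tT TM m_inv_consistent[OF M, of t] subsetD[OF TM tT] by simp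
      then have "x \<otimes>\<^bsub>G\<^esub> (t \<otimes>\<^bsub>G\<^esub> inv\<^bsub>G\<^esub> x \<otimes>\<^bsub>G\<^esub> inv\<^bsub>G\<^esub> t) \<in> V"
        using subgroup.m_closed[OF V.subgroup_axioms xV] by simp
      then show ?thesis
        using x t by (simp add: m_assoc)
    qed
    ultimately have "?c \<in> R"
      using TV by blast
    then have "R #>\<^bsub>G\<^esub> (x \<otimes>\<^bsub>G\<^esub> t) = R #>\<^bsub>G\<^esub> (t \<otimes>\<^bsub>G\<^esub> x)"
    proof -
      assume c: "?c \<in> R"
      have "R #>\<^bsub>G\<^esub> (t \<otimes>\<^bsub>G\<^esub> x) = R #>\<^bsub>G\<^esub> ?c #>\<^bsub>G\<^esub> (t \<otimes>\<^bsub>G\<^esub> x)"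
        using coset_join2[OF _ R.subgroup_axioms c] c by simp
      also have "\<dots> = R #>\<^bsub>G\<^esub> (?c \<otimes>\<^bsub>G\<^esub> (t \<otimes>\<^bsub>G\<^esub> x))"
        using x t by (simp add: coset_mult_assoc R.subset)
      also have "?c \<otimes>\<^bsub>G\<^esub> (t \<otimes>\<^bsub>G\<^esub> x) = x \<otimes>\<^bsub>G\<^esub> t"
        using x t by (simp add: m_assoc flip: m_assoc[of "inv\<^bsub>G\<^esub> t" t] m_assoc[of "inv\<^bsub>G\<^esub> x" x])
      finally show ?thesis by simp
    qed
    then show "(R #>\<^bsub>G\<^esub> x) \<otimes>\<^bsub>G Mod R\<^esub> U = U \<otimes>\<^bsub>G Mod R\<^esub> (R #>\<^bsub>G\<^esub> x)"
      using x t by (simp add: Ut R.rcos_sum)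
  qed
  then show "x \<in> radical_series G (Suc i)"
    using x unfolding R_def by simp
qed

text \<open>The supplement makes the quotient map of \<open>G\<close> modulo its \<open>j\<close>-th
  term surjective on \<open>M\<close>. By \<open>sub\<close> it factors through \<open>M\<close>
  modulo its \<open>i\<close>-th term, and an epimorphism carries the radical into the
  radical.\<close>

lemma radical_series_supplement:
  assumes gG: "group G" and fin: "finite (carrier G)" and M: "subgroup M G"
    and supp: "carrier G = radical_series G j <#>\<^bsub>G\<^esub> M"
    and sub: "radical_series (G\<lparr>carrier := M\<rparr>) i \<subseteq> radical_series G j"
  shows "radical_series (G\<lparr>carrier := M\<rparr>) (Suc i) \<subseteq> radical_series G (Suc j)"
proof
  interpret group G by (rule gG)
  interpret M: subgroup M G by (rule M)
  let ?M = "G\<lparr>carrier := M\<rparr>" and ?T = "radical_series G j" and ?V = "radical_series (G\<lparr>carrier := M\<rparr>) i"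
  have gM: "group ?M"
    using M by (rule subgroup_imp_group)
  have finM: "finite (carrier ?M)"
    using finite_subset[OF M.subset fin] by simp
  have V: "?V \<lhd> ?M"
    using radical_series_normal[OF gM finM] .
  interpret T: normal ?T G
    using radical_series_normal[OF gG fin] .
  have hom: "group_hom ?M (G Mod ?T) ((#>\<^bsub>G\<^esub>) ?T)"
  proof (rule group_homI[OF gM T.factorgroup_is_group])
    show "(#>\<^bsub>G\<^esub>) ?T \<in> hom ?M (G Mod ?T)"
      using T.rcos_sum by (intro homI) (auto simp: carrier_FactGroup)
  qed
  have "(#>\<^bsub>G\<^esub>) ?T ` M = carrier (G Mod ?T)"
  proof
    show "carrier (G Mod ?T) \<subseteq> (#>\<^bsub>G\<^esub>) ?T ` M"
    proof
      fix U assume "U \<in> carrier (G Mod ?T)"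
      then obtain g where g: "g \<in> carrier G" "U = ?T #>\<^bsub>G\<^esub> g"
        by (auto simp: carrier_FactGroup)
      then obtain t m where tm: "t \<in> ?T" "m \<in> M" "g = t \<otimes>\<^bsub>G\<^esub> m"
        using supp by (auto simp: set_mult_def)
      have "U = ?T #>\<^bsub>G\<^esub> t #>\<^bsub>G\<^esub> m"
        using g(2) tm by (simp add: coset_mult_assoc T.subset)
      also have "\<dots> = ?T #>\<^bsub>G\<^esub> m"
        using coset_join2[OF _ T.subgroup_axioms tm(1)] tm(1) by simp
      finally show "U \<in> (#>\<^bsub>G\<^esub>) ?T ` M"
        using tm(2) by blast
    qed
  qed (auto simp: carrier_FactGroup)
  then have im: "(#>\<^bsub>G\<^esub>) ?T ` carrier ?M \<lhd> G Mod ?T"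
    using group.normal_self[OF T.factorgroup_is_group] by simp
  have ker: "?T #>\<^bsub>G\<^esub> y = \<one>\<^bsub>G Mod ?T\<^esub>" if "y \<in> ?V" for y
    using that sub T.r_coset_eq_self_iff[of y] T.mem_carrier by auto
  fix x assume "x \<in> radical_series ?M (Suc i)"
  then have x: "x \<in> carrier ?M" "?V #>\<^bsub>?M\<^esub> x \<in> class_radical F (?M Mod ?V)"
    by simp_all
  have "?T #>\<^bsub>G\<^esub> x \<in> class_radical F (G Mod ?T)"
    using class_radical_Mod_hom[OF hom finM T.finite_Mod[OF fin] V ker im x] .
  then show "x \<in> radical_series G (Suc j)"
    using x(1) by simp
qed

text \<open>Maximality splits the induction step: either \<open>?T\<close> lies in \<open>M\<close>,
  or \<open>?T\<close> and \<open>M\<close> together give \<open>G\<close>. The second case advances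
  both indices by one.\<close>

lemma radical_series_maximal_subgroup:
  assumes pi: "pi_group (class_primes F) G" and sol: "solvable G" and max: "maximal_subgroup M G"
  shows "radical_series (G\<lparr>carrier := M\<rparr>) i \<subseteq> radical_series G (i + 2)"
proof (induction i)
  case 0
  have "group G" "finite (carrier G)"
    using pi by (simp_all add: pi_group_def)
  then have "\<one>\<^bsub>G\<^esub> \<in> radical_series G (0 + 2)"
    by (intro subgroup.one_closed normal_imp_subgroup radical_series_normal)
  then show ?case
    by (simp only: gamma_series.simps) simp
next
  case (Suc i)
  interpret group G
    using pi by (simp add: pi_group_def)
  have fin: "finite (carrier G)"
    using pi by (simp add: pi_group_def)
  have M: "subgroup M G"
    using max by (simp add: maximal_subgroup_def)
  let ?T = "radical_series G (i + 2)"
  have T: "?T \<lhd> G"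
    using radical_series_normal[OF is_group fin] .
  show ?case
  proof (cases "?T \<subseteq> M")
    case True
    \<comment> \<open>In this case the shift is only 1, one better than claimed; monotonicity of the
      series gives away the difference.\<close>
    have "radical_series (G\<lparr>carrier := M\<rparr>) (Suc i) \<subseteq> radical_series G (Suc (Suc i))"
      using radical_series_subgroup_above[OF pi sol M, of "Suc i"] True by simp
    also have "\<dots> \<subseteq> radical_series G (Suc i + 2)"
      by (rule radical_series_mono[OF is_group fin]) simp
    finally show ?thesis .
  next
    case False
    have "subgroup (?T <#>\<^bsub>G\<^esub> M) G"
      using mult_norm_subgroup[OF T M] .
    moreover have "?T \<subseteq> ?T <#>\<^bsub>G\<^esub> M" "M \<subseteq> ?T <#>\<^bsub>G\<^esub> M"
      using subset_set_mult[OF normal_imp_subgroup[OF T] M] .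
    ultimately have "carrier G = ?T <#>\<^bsub>G\<^esub> M"
      using max False unfolding maximal_subgroup_def by metis
    then show ?thesis
      using radical_series_supplement[OF is_group fin M _ Suc.IH] by simp
  qed
qed

text \<open>The containment of \<open>M\<close> in term \<open>k + 2\<close> of \<open>G\<close>
  would by itself only give length at most \<open>k + 3\<close>. If that term were \<open>M\<close>,
  then \<open>M\<close> would be normal and its series the intersection with that of
  \<open>G\<close>. Already term \<open>k\<close> of \<open>G\<close> would then contain
  \<open>M\<close>, and the series would stall at a proper subgroup.\<close>

lemma radical_series_maximal_reaches:
  assumes pi: "pi_group (class_primes F) G" and sol: "solvable G" and max: "maximal_subgroup M G"
    and k: "radical_series (G\<lparr>carrier := M\<rparr>) k = M"
  shows "radical_series G (k + 2) = carrier G"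
proof (rule ccontr)
  assume neq: "radical_series G (k + 2) \<noteq> carrier G"
  have fin: "finite (carrier G)" and gG: "group G"
    using pi by (simp_all add: pi_group_def)
  have normal: "radical_series G j \<lhd> G" for j
    using radical_series_normal[OF gG fin] .
  have "M \<subseteq> radical_series G (k + 2)"
    using radical_series_maximal_subgroup[OF pi sol max, of k] k by simp
  then have eq: "radical_series G (k + 2) = M"
    using max neq normal_imp_subgroup[OF normal] unfolding maximal_subgroup_def by metis
  then have "M \<lhd> G"
    using normal by metis
  then have "M \<subseteq> radical_series G k"
    using radical_series_of_normal[OF _ fin, of M k] k by auto
  moreover have "radical_series G k \<subseteq> radical_series G (Suc k)"
    "radical_series G (Suc k) \<subseteq> radical_series G (k + 2)"
    by (rule radical_series_mono[OF gG fin], simp)+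
  ultimately have "radical_series G (Suc k) = radical_series G k" "radical_series G k = M"
    using eq by blast+
  then show False
    using radical_series_Suc_neq[OF pi sol, of k] eq neq by simp
qed

end

theorem corollary2p1:
  fixes F :: "nat monoid set" and G :: "('a, 'b) monoid_scheme" and M :: "'a set"
  assumes "fitting_class F" and "Q_closed F" and "\<forall>H\<in>F. solvable H"
    and "group G" and "finite (carrier G)" and "solvable G"
    and "pi_group (class_primes F) G"
    and "maximal_subgroup M G"
  shows "gamma_length (class_radical F) G - gamma_length (class_radical F) (G\<lparr>carrier := M\<rparr>) \<le> 2"
proof -
  interpret soluble_Q_fitting_class F
    using assms(1-3) by unfold_locales simp_all
  let ?M = "G\<lparr>carrier := M\<rparr>"
  have pi: "pi_group (class_primes F) G" and sol: "solvable G"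
    by fact+
  obtain h where h: "radical_series G h = carrier G"
    using radical_series_reaches[OF pi sol] .
  show ?thesis
  proof (cases "\<exists>k. radical_series ?M k = M")
    case True
    define k where "k = (LEAST k. radical_series ?M k = M)"
    have "radical_series ?M k = M"
      unfolding k_def using True by (rule LeastI_ex)
    then have "radical_series G (k + 2) = carrier G"
      using radical_series_maximal_reaches[OF pi sol assms(8)] by simp
    then have "(LEAST h. radical_series G h = carrier G) \<le> k + 2"
      by (rule Least_le)
    moreover have "gamma_length (class_radical F) ?M = enat k"
      using True by (simp add: gamma_length_def k_def)
    moreover have "gamma_length (class_radical F) G = enat (LEAST h. radical_series G h = carrier G)"
      using h by (auto simp: gamma_length_def)
    \<comment> \<open>Subtraction on \<open>enat\<close> truncates at 0, so the claim amounts to the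
      bound \<open>k + 2\<close> on the length of \<open>G\<close>.\<close>
    ultimately show ?thesis
      by (simp add: numeral_eq_enat)
  next
    case False
    \<comment> \<open>A finite value minus infinity is 0 in \<open>enat\<close>, whereas infinity
      minus infinity is infinity; so it is the finite length of \<open>G\<close> that settles this
      case.\<close>
    then have "gamma_length (class_radical F) ?M = \<infinity>"
      by (simp add: gamma_length_def)
    moreover have "gamma_length (class_radical F) G = enat (LEAST h. radical_series G h = carrier G)"
      using h by (auto simp: gamma_length_def)
    ultimately show ?thesis by simp
  qed
qed

end
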